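(* Let $M$ be a smooth manifold, let $c$ be a normal 0-current on $M$ that is a boundary, and let $E$ be a space of functions on $TM$ as described in the context. Let $L$ be an element of $E$ and assume that the action functional $\nu\mapsto\int_{TM}L\,d\nu$ of $L$ reaches its minimum within $\mathscr H(c)$ at a minimizer $\mu$. Define the Hamiltonian associated to $L$ to be the function on $T^*M$ given by $$H(x,u)=\sup_{v\in T_xM}\bigl(u(v)-L(x,v)\bigr),\qquad x\in M,\ u\in T^*_xM.$$ Then the value of $H$ is constant throughout $\mu$-almost all the support of $\mu$ and equals $$H(x,u)=\begin{cases}-\int_{TM}L\,d\mu,&c=0,\\ 0,&c\neq0,\end{cases}\qquad u=\frac{\partial L}{\partial v}(x,v),\ (x,v)\in\operatorname{supp}\mu.$$
   Context: $M$ is a second-countable smooth manifold of dimension $d\ge1$; $\partial/\partial v$ denotes differentiation in the fiberwise direction of $T_xM$. For a manifold $X$, $C^\infty(X)$ carries the topology induced by the seminorms $|f|_{K,k}=\sum_{|I|\le k}\sup_{x\in K}|\partial^I f(x)|$, for $K\subseteq X$ compact and $k$ a positive integer. For $f\in C^1(M)$, $df$ is regarded as the function $(x,v)\mapsto df_x(v)$ on $TM$. A normal 0-current is a continuous functional $C^\infty(M)\to\mathbb{R}$ given by a signed, Radon, compactly supported measure on $M$. For a compactly supported Radon measure $\mu$ on $TM$, its boundary $\partial\mu\colon C^1(M)\to\mathbb{R}$ is $\langle\partial\mu,f\rangle=\int_{TM}df\,d\mu$. The current $c$ is a boundary if $c=\partial\mu$ for some such $\mu$. For a normal 0-current $c$,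 $\mathscr H(c)$ is the set of compactly supported, positive, Radon measures $\mu$ on $TM$ with $\partial\mu=c$; when $c=0$, the elements of $\mathscr H(0)$ are additionally required to be probability measures. $E$ is a complete, sequential, locally convex topological vector space of Borel measurable functions on $TM$ that contains $C^\infty(TM)$ as a subset; it is assumed that $\mathscr H(c)\subset E^*$ (each measure acting by integration) and that the topology of $C^\infty(TM)$ induced by the seminorms $|\cdot|_{K,k}$ (with $X=TM$) is finer than the one it inherits from $E$. (For example, $E$ could be a space of $C^\ell$ functions on $TM$, $\ell\in[0,\infty]$, with the topology induced by the seminorms $|\cdot|_{K,k}$, $K\subseteq TM$ compact, with $k\le\ell$.) *)

theory Defs
  imports "HOL-Analysis.Analysis"
begin

section \<open>Functions of class \<open>C\<^sup>k\<close> on open subsets of a Euclidean space\<close>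

text \<open>Only meaningful for open \<open>S\<close>. A function is of class \<open>C\<^sup>k\<close> if it is differentiable
  and all its first partial derivatives are of class \<open>C\<^sup>k\<^sup>-\<^sup>1\<close>.\<close>

primrec Ck_on :: "nat \<Rightarrow> ('e::euclidean_space \<Rightarrow> 'b::real_normed_vector) \<Rightarrow> 'e set \<Rightarrow> bool" where
  "Ck_on 0 f S \<longleftrightarrow> continuous_on S f"
| "Ck_on (Suc k) f S \<longleftrightarrow> (\<forall>x\<in>S. f differentiable (at x)) \<and>
     (\<forall>b\<in>Basis. Ck_on k (\<lambda>x. frechet_derivative f (at x) b) S)"

definition smooth_on :: "('e::euclidean_space \<Rightarrow> 'b::real_normed_vector) \<Rightarrow> 'e set \<Rightarrow> bool" where
  "smooth_on f S \<longleftrightarrow> (\<forall>k. Ck_on k f S)"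

text \<open>The iterated partial derivative along a finite sequence of basis directions.\<close>

primrec iter_partial :: "'e::euclidean_space list \<Rightarrow> ('e \<Rightarrow> real) \<Rightarrow> 'e \<Rightarrow> real" where
  "iter_partial [] f = f"
| "iter_partial (b # I) f = iter_partial I (\<lambda>x. frechet_derivative f (at x) b)"


section \<open>Smooth manifolds\<close>

text \<open>A chart is a pair of its domain and its coordinate map; the values of the map outside the
  domain are irrelevant. The atlas need not be maximal.
  The dimension is \<open>DIM('e)\<close>, which is always at least 1.\<close>

type_synonym ('a, 'e) chart = "'a set \<times> ('a \<Rightarrow> 'e)"

record ('a, 'e) manifold =
  mtop :: "'a topology"
  atlas :: "('a, 'e) chart set"

abbreviation chart_dom :: "('a, 'e) chart \<Rightarrow> 'a set" where
  "chart_dom \<kappa> \<equiv> fst \<kappa>"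

abbreviation chart_map :: "('a, 'e) chart \<Rightarrow> 'a \<Rightarrow> 'e" where
  "chart_map \<kappa> \<equiv> snd \<kappa>"

definition chart_inv :: "('a, 'e) chart \<Rightarrow> 'e \<Rightarrow> 'a" where
  "chart_inv \<kappa> = inv_into (chart_dom \<kappa>) (chart_map \<kappa>)"

definition charts_at :: "('a, 'e) manifold \<Rightarrow> 'a \<Rightarrow> ('a, 'e) chart set" where
  "charts_at M x = {\<kappa> \<in> atlas M. x \<in> chart_dom \<kappa>}"

definition second_countable_top :: "'a topology \<Rightarrow> bool" where
  "second_countable_top X \<longleftrightarrow> (\<exists>\<B>. countable \<B> \<and> (\<forall>V\<in>\<B>. openin X V) \<and>
     (\<forall>U x. openin X U \<and> x \<in> U \<longrightarrow> (\<exists>V\<in>\<B>. x \<in> V \<and> V \<subseteq> U)))"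

definition smooth_manifold :: "('a, 'e::euclidean_space) manifold \<Rightarrow> bool" where
  "smooth_manifold M \<longleftrightarrow>
     Hausdorff_space (mtop M) \<and> second_countable_top (mtop M) \<and>
     (\<forall>\<kappa>\<in>atlas M. openin (mtop M) (chart_dom \<kappa>) \<and> open (chart_map \<kappa> ` chart_dom \<kappa>) \<and>
        homeomorphic_map (subtopology (mtop M) (chart_dom \<kappa>))
          (top_of_set (chart_map \<kappa> ` chart_dom \<kappa>)) (chart_map \<kappa>)) \<and>
     (\<Union>\<kappa>\<in>atlas M. chart_dom \<kappa>) = topspace (mtop M) \<and>
     (\<forall>\<kappa>\<in>atlas M. \<forall>\<kappa>'\<in>atlas M.
        smooth_on (chart_map \<kappa>' \<circ> chart_inv \<kappa>) (chart_map \<kappa> ` (chart_dom \<kappa> \<inter> chart_dom \<kappa>')))"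

text \<open>A function on a manifold is represented by its extension by 0 to the whole type, so that
  equality and the pointwise vector space operations are those of functions on the manifold.\<close>

definition Ck_fun :: "nat \<Rightarrow> ('a, 'e::euclidean_space) manifold \<Rightarrow> ('a \<Rightarrow> real) set" where
  "Ck_fun k M = {f. (\<forall>x. x \<notin> topspace (mtop M) \<longrightarrow> f x = 0) \<and>
     (\<forall>\<kappa>\<in>atlas M. Ck_on k (f \<circ> chart_inv \<kappa>) (chart_map \<kappa> ` chart_dom \<kappa>))}"

definition smooth_fun :: "('a, 'e::euclidean_space) manifold \<Rightarrow> ('a \<Rightarrow> real) set" where
  "smooth_fun M = (\<Inter>k. Ck_fun k M)"

text \<open>The seminorm \<open>|f|\<^bsub>K,k\<^esub>\<close>, for \<open>K\<close> a nonempty compact subset of the domain of \<open>\<kappa>\<close>, the partial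
  derivatives being taken in the coordinates \<open>\<kappa>\<close>. Every compact subset of the manifold is a finite
  union of such \<open>K\<close>. The sum is over sequences of directions, so that a mixed derivative occurs once
  for each ordering of its directions, which yields an equivalent seminorm.\<close>

definition Ck_seminorm ::
  "('a, 'e::euclidean_space) chart \<Rightarrow> 'a set \<Rightarrow> nat \<Rightarrow> ('a \<Rightarrow> real) \<Rightarrow> real" where
  "Ck_seminorm \<kappa> K k f =
     (\<Sum>I\<in>{I. set I \<subseteq> Basis \<and> length I \<le> k}.
        SUP x\<in>K. \<bar>iter_partial I (f \<circ> chart_inv \<kappa>) (chart_map \<kappa> x)\<bar>)"

definition smooth_topology :: "('a, 'e::euclidean_space) manifold \<Rightarrow> ('a \<Rightarrow> real) topology" where
  "smooth_topology M = topology_generated_by (insert (smooth_fun M)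
     {{g \<in> smooth_fun M. Ck_seminorm \<kappa> K k (\<lambda>x. g x - f x) < \<epsilon>} | f \<kappa> K k \<epsilon>.
        f \<in> smooth_fun M \<and> \<kappa> \<in> atlas M \<and> compactin (mtop M) K \<and> K \<subseteq> chart_dom \<kappa> \<and> K \<noteq> {} \<and>
        0 < k \<and> 0 < \<epsilon>})"


section \<open>Tangent and cotangent spaces\<close>

text \<open>A tangent vector at \<open>x\<close> is the family of its coordinate vectors in the charts at \<open>x\<close>, which
  are related by the derivatives of the coordinate changes. The vector space operations of \<open>T\<^sub>xM\<close>
  are the pointwise ones.\<close>

definition tangent_space ::
  "('a, 'e::euclidean_space) manifold \<Rightarrow> 'a \<Rightarrow> (('a, 'e) chart \<Rightarrow> 'e) set" where
  "tangent_space M x = {v. (\<forall>\<kappa>. \<kappa> \<notin> charts_at M x \<longrightarrow> v \<kappa> = 0) \<and>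
     (\<forall>\<kappa>\<in>charts_at M x. \<forall>\<kappa>'\<in>charts_at M x.
        v \<kappa>' = frechet_derivative (chart_map \<kappa>' \<circ> chart_inv \<kappa>) (at (chart_map \<kappa> x)) (v \<kappa>))}"

text \<open>The tangent vector at \<open>x\<close> with coordinates \<open>\<xi>\<close> in the chart \<open>\<kappa>\<close>.\<close>

definition tangent_vec ::
  "('a, 'e::euclidean_space) manifold \<Rightarrow> 'a \<Rightarrow> ('a, 'e) chart \<Rightarrow> 'e \<Rightarrow> (('a, 'e) chart \<Rightarrow> 'e)" where
  "tangent_vec M x \<kappa> = inv_into (tangent_space M x) (\<lambda>v. v \<kappa>)"

text \<open>Linear functionals on \<open>T\<^sub>xM\<close>; their values outside \<open>T\<^sub>xM\<close> are irrelevant.\<close>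

definition cotangent_space ::
  "('a, 'e::euclidean_space) manifold \<Rightarrow> 'a \<Rightarrow> ((('a, 'e) chart \<Rightarrow> 'e) \<Rightarrow> real) set" where
  "cotangent_space M x = {u. \<forall>v\<in>tangent_space M x. \<forall>w\<in>tangent_space M x. \<forall>a b.
     u (\<lambda>\<kappa>. a *\<^sub>R v \<kappa> + b *\<^sub>R w \<kappa>) = a * u v + b * u w}"

definition tangent_chart ::
  "('a, 'e::euclidean_space) manifold \<Rightarrow> ('a, 'e) chart \<Rightarrow>
     ('a \<times> (('a, 'e) chart \<Rightarrow> 'e), 'e \<times> 'e) chart" where
  "tangent_chart M \<kappa> = (SIGMA x:chart_dom \<kappa>. tangent_space M x, \<lambda>(x, v). (chart_map \<kappa> x, v \<kappa>))"

definition tangent_bundle ::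
  "('a, 'e::euclidean_space) manifold \<Rightarrow> ('a \<times> (('a, 'e) chart \<Rightarrow> 'e), 'e \<times> 'e) manifold" where
  "tangent_bundle M =
     \<lparr>mtop = topology_generated_by
        {{p \<in> chart_dom \<kappa>. chart_map \<kappa> p \<in> W} | \<kappa> W. \<kappa> \<in> tangent_chart M ` atlas M \<and> open W},
      atlas = tangent_chart M ` atlas M\<rparr>"

text \<open>\<open>df\<close> as a function on the tangent bundle; the value does not depend on the chosen chart.\<close>

definition differential ::
  "('a, 'e::euclidean_space) manifold \<Rightarrow> ('a \<Rightarrow> real) \<Rightarrow> 'a \<times> (('a, 'e) chart \<Rightarrow> 'e) \<Rightarrow> real" where
  "differential M f = (\<lambda>(x, v). let \<kappa> = (SOME \<kappa>. \<kappa> \<in> charts_at M x) in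
     frechet_derivative (f \<circ> chart_inv \<kappa>) (at (chart_map \<kappa> x)) (v \<kappa>))"

text \<open>\<open>u = \<partial>L/\<partial>v (x, v)\<close>: the covector \<open>u\<close> is the (Frechet) derivative at \<open>v\<close> of \<open>L(x, \<cdot>)\<close> on the
  finite-dimensional space \<open>T\<^sub>xM\<close>, written in linear coordinates.\<close>

definition has_fiber_derivative ::
  "('a, 'e::euclidean_space) manifold \<Rightarrow> ('a \<times> (('a, 'e) chart \<Rightarrow> 'e) \<Rightarrow> real) \<Rightarrow>
     ((('a, 'e) chart \<Rightarrow> 'e) \<Rightarrow> real) \<Rightarrow> 'a \<Rightarrow> (('a, 'e) chart \<Rightarrow> 'e) \<Rightarrow> bool" where
  "has_fiber_derivative M L u x v \<longleftrightarrow> u \<in> cotangent_space M x \<and>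
     (\<forall>\<kappa>\<in>charts_at M x. ((\<lambda>\<xi>. L (x, tangent_vec M x \<kappa> \<xi>)) has_derivative
        (\<lambda>\<xi>. u (tangent_vec M x \<kappa> \<xi>))) (at (v \<kappa>)))"

text \<open>The supremum may be \<open>\<infinity>\<close>.\<close>

definition hamiltonian ::
  "('a, 'e::euclidean_space) manifold \<Rightarrow> ('a \<times> (('a, 'e) chart \<Rightarrow> 'e) \<Rightarrow> real) \<Rightarrow>
     'a \<Rightarrow> ((('a, 'e) chart \<Rightarrow> 'e) \<Rightarrow> real) \<Rightarrow> ereal" where
  "hamiltonian M L x u = (SUP v\<in>tangent_space M x. ereal (u v - L (x, v)))"


section \<open>Measures and currents\<close>

definition borel_of :: "'a topology \<Rightarrow> 'a measure" where
  "borel_of X = sigma (topspace X) {U. openin X U}"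

definition radon_measure :: "'a topology \<Rightarrow> 'a measure \<Rightarrow> bool" where
  "radon_measure X \<mu> \<longleftrightarrow> space \<mu> = topspace X \<and> sets \<mu> = sets (borel_of X) \<and>
     (\<forall>K. compactin X K \<and> K \<in> sets \<mu> \<longrightarrow> emeasure \<mu> K < \<infinity>) \<and>
     (\<forall>A\<in>sets \<mu>. emeasure \<mu> A =
        (SUP K\<in>{K. compactin X K \<and> K \<in> sets \<mu> \<and> K \<subseteq> A}. emeasure \<mu> K))"

definition msupport :: "'a topology \<Rightarrow> 'a measure \<Rightarrow> 'a set" where
  "msupport X \<mu> = {x \<in> topspace X. \<forall>U. openin X U \<and> x \<in> U \<longrightarrow> emeasure \<mu> U > 0}"

definition compact_radon :: "'a topology \<Rightarrow> 'a measure set" where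
  "compact_radon X = {\<mu>. radon_measure X \<mu> \<and> compactin X (msupport X \<mu>)}"

text \<open>A signed compactly supported Radon measure is a difference of two positive ones. Currents are
  functionals on \<open>C\<^sup>\<infinity>(M)\<close>; their values on other functions are irrelevant.\<close>

definition normal_0_current ::
  "('a, 'e::euclidean_space) manifold \<Rightarrow> (('a \<Rightarrow> real) \<Rightarrow> real) \<Rightarrow> bool" where
  "normal_0_current M c \<longleftrightarrow> continuous_map (smooth_topology M) euclideanreal c \<and>
     (\<exists>m\<^sub>1\<in>compact_radon (mtop M). \<exists>m\<^sub>2\<in>compact_radon (mtop M).
        \<forall>f\<in>smooth_fun M. c f = (\<integral>x. f x \<partial>m\<^sub>1) - (\<integral>x. f x \<partial>m\<^sub>2))"

definition zero_current ::
  "('a, 'e::euclidean_space) manifold \<Rightarrow> (('a \<Rightarrow> real) \<Rightarrow> real) \<Rightarrow> bool" where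
  "zero_current M c \<longleftrightarrow> (\<forall>f\<in>smooth_fun M. c f = 0)"

definition boundary ::
  "('a, 'e::euclidean_space) manifold \<Rightarrow> ('a \<times> (('a, 'e) chart \<Rightarrow> 'e)) measure \<Rightarrow>
     ('a \<Rightarrow> real) \<Rightarrow> real" where
  "boundary M \<mu> f = (\<integral>p. differential M f p \<partial>\<mu>)"

text \<open>\<open>\<partial>\<mu>\<close> is continuous on \<open>C\<^sup>1(M)\<close>, where \<open>C\<^sup>\<infinity>(M)\<close> is dense, so \<open>\<partial>\<mu> = c\<close> may be tested on \<open>C\<^sup>\<infinity>(M)\<close>.\<close>

definition fillings ::
  "('a, 'e::euclidean_space) manifold \<Rightarrow> (('a \<Rightarrow> real) \<Rightarrow> real) \<Rightarrow>
     ('a \<times> (('a, 'e) chart \<Rightarrow> 'e)) measure set" where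
  "fillings M c = {\<mu> \<in> compact_radon (mtop (tangent_bundle M)).
     \<forall>f\<in>smooth_fun M. boundary M \<mu> f = c f}"

definition is_boundary ::
  "('a, 'e::euclidean_space) manifold \<Rightarrow> (('a \<Rightarrow> real) \<Rightarrow> real) \<Rightarrow> bool" where
  "is_boundary M c \<longleftrightarrow> fillings M c \<noteq> {}"

text \<open>\<open>\<H>(c)\<close>\<close>

definition competitors ::
  "('a, 'e::euclidean_space) manifold \<Rightarrow> (('a \<Rightarrow> real) \<Rightarrow> real) \<Rightarrow>
     ('a \<times> (('a, 'e) chart \<Rightarrow> 'e)) measure set" where
  "competitors M c = {\<mu> \<in> fillings M c. zero_current M c \<longrightarrow> emeasure \<mu> (space \<mu>) = 1}"


section \<open>Topological vector spaces of functions\<close>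

definition lctvs :: "('b \<Rightarrow> real) topology \<Rightarrow> bool" where
  "lctvs T \<longleftrightarrow> (\<lambda>x. 0) \<in> topspace T \<and>
     continuous_map (prod_topology T T) T (\<lambda>(f, g) x. f x + g x) \<and>
     continuous_map (prod_topology euclideanreal T) T (\<lambda>(a, f) x. a * f x) \<and>
     (\<forall>U. openin T U \<and> (\<lambda>x. 0) \<in> U \<longrightarrow> (\<exists>V. openin T V \<and> (\<lambda>x. 0) \<in> V \<and> V \<subseteq> U \<and>
        (\<forall>f\<in>V. \<forall>g\<in>V. \<forall>t\<in>{0..1}. (\<lambda>x. (1 - t) * f x + t * g x) \<in> V)))"

definition complete_tvs :: "('b \<Rightarrow> real) topology \<Rightarrow> bool" where
  "complete_tvs T \<longleftrightarrow> (\<forall>F. F \<noteq> bot \<and> eventually (\<lambda>f. f \<in> topspace T) F \<and>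
     (\<forall>U. openin T U \<and> (\<lambda>x. 0) \<in> U \<longrightarrow>
        (\<exists>A. eventually (\<lambda>f. f \<in> A) F \<and> (\<forall>f\<in>A. \<forall>g\<in>A. (\<lambda>x. f x - g x) \<in> U)))
     \<longrightarrow> (\<exists>l. limitin T (\<lambda>f. f) l F))"

definition sequential_top :: "'b topology \<Rightarrow> bool" where
  "sequential_top X \<longleftrightarrow> (\<forall>S\<subseteq>topspace X.
     (\<forall>s l. (\<forall>n. s n \<in> S) \<and> limitin X s l sequentially \<longrightarrow> l \<in> S) \<longrightarrow> closedin X S)"

definition continuous_dual :: "('b \<Rightarrow> real) topology \<Rightarrow> (('b \<Rightarrow> real) \<Rightarrow> real) set" where
  "continuous_dual T = {\<Lambda>. continuous_map T euclideanreal \<Lambda> \<and>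
     (\<forall>f\<in>topspace T. \<forall>g\<in>topspace T. \<forall>a b. \<Lambda> (\<lambda>x. a * f x + b * g x) = a * \<Lambda> f + b * \<Lambda> g)}"

text \<open>The space \<open>E\<close> is \<open>topspace T\<close>, with the topology \<open>T\<close>. It need not be Hausdorff.\<close>

definition admissible_space ::
  "('a, 'e::euclidean_space) manifold \<Rightarrow> (('a \<Rightarrow> real) \<Rightarrow> real) \<Rightarrow>
     ('a \<times> (('a, 'e) chart \<Rightarrow> 'e) \<Rightarrow> real) topology \<Rightarrow> bool" where
  "admissible_space M c T \<longleftrightarrow>
     lctvs T \<and> complete_tvs T \<and> sequential_top T \<and>
     (\<forall>f\<in>topspace T. f \<in> borel_measurable (borel_of (mtop (tangent_bundle M))) \<and>
        (\<forall>p. p \<notin> topspace (mtop (tangent_bundle M)) \<longrightarrow> f p = 0)) \<and>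
     smooth_fun (tangent_bundle M) \<subseteq> topspace T \<and>
     (\<forall>\<nu>\<in>competitors M c. (\<forall>f\<in>topspace T. integrable \<nu> f) \<and>
        (\<lambda>f. \<integral>p. f p \<partial>\<nu>) \<in> continuous_dual T) \<and>
     (\<forall>U. openin (subtopology T (smooth_fun (tangent_bundle M))) U \<longrightarrow>
        openin (smooth_topology (tangent_bundle M)) U)"

end

theory Submission
  imports Defs
begin

text \<open>
  Put \<open>\<Lambda> = \<integral>L d\<mu>\<close> if \<open>c = 0\<close> and \<open>\<Lambda> = 0\<close> otherwise. The mass that \<open>\<mu>\<close> gives to a velocity \<open>v\<close> at \<open>x\<close> may be
  replaced by masses \<open>a\<close> at \<open>w\<close> and \<open>b\<close> at \<open>z\<close> whenever \<open>a w + b z = v\<close>: as \<open>df\<close> is linear on fibres,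
  the boundary does not change. The total mass does, which is harmless for \<open>c \<noteq> 0\<close> and is repaired by
  rescaling for \<open>c = 0\<close>. Minimality therefore forces, for \<open>\<mu>\<close>-almost every \<open>(x, v)\<close> and all \<open>w\<close>, \<open>z\<close>
  as above, \<open>L(x, v) - \<Lambda> \<le> a (L(x, w) - \<Lambda>) + b (L(x, z) - \<Lambda>)\<close>. With \<open>a = s\<close>, \<open>b = 1\<close>, \<open>s \<rightarrow> 0\<close> this yields
  \<open>u(w) \<le> L(x, w) - \<Lambda>\<close>; with \<open>a = 0\<close>, \<open>b = 1 - s\<close> it yields \<open>L(x, v) - \<Lambda> \<le> u(v)\<close>. So the supremum
  defining \<open>H(x, u)\<close> is \<open>-\<Lambda>\<close>, attained at \<open>v\<close>.

  Since \<open>L\<close> is only Borel, the set of \<open>(x, v)\<close> for which the inequality fails for some \<open>w\<close> is merely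
  analytic. If it is not null, Choquet capacitability supplies a compact set of positive measure on
  which such a \<open>w\<close> depends continuously on \<open>(x, v)\<close>, and the replacement above can be carried out there.
\<close>

section \<open>Continuous selections from Borel sets\<close>

text \<open>Why the replacement must depend continuously on the point and live over a compact set:
  the new measure has to be a competitor again, so its support must be compact, and images of a
  compact set under continuous maps guarantee this. A merely measurable choice of \<open>w\<close>
  could scatter mass over a noncompact set. Once the new measure is a competitor, integrability of
  \<open>L\<close> against it comes from \<open>admissible_space\<close>, although \<open>L\<close>
  may be unbounded on compact sets.

  The number \<open>\<Lambda>\<close> is the Lagrange multiplier of the mass constraint. For
  \<open>c = 0\<close> the integral of \<open>L - \<Lambda>\<close> vanishes against
  \<open>\<mu>\<close>, so multiplying a perturbation by a positive factor cannot change the sign of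
  the gain; for \<open>c \<noteq> 0\<close> mass is unconstrained and the multiplier is 0.

  Since \<open>z = (v - a w) / b\<close> is determined by \<open>w\<close>, only \<open>w\<close>
  has to be selected. Each pair \<open>(a, b)\<close> has its own exceptional null set, so the limit
  \<open>s \<rightarrow> 0\<close> is taken along \<open>s = 1/n\<close>; this is enough to fix the
  sign of a derivative at 0. The selection theorem is proved in Euclidean space and transported to
  the tangent bundle through countably many charts.\<close>

text \<open>The second factor is Baire space with \<open>nat\<close> discrete. Insisting on a closed
  set \<open>D\<close> is what later turns coordinatewise bounds on the witnesses into
  compactness.\<close>

definition analytic_set :: "'z::topological_space set \<Rightarrow> bool" where
  "analytic_set C \<longleftrightarrow> (\<exists>D :: ('z \<times> (nat \<Rightarrow> nat)) set. closed D \<and> C = fst ` D)"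

text \<open>Used for decoding witnesses: \<open>h = Suc\<close> drops the first entry, and
  \<open>h\<close> given by \<open>prod_encode (n, i)\<close> extracts the \<open>n\<close>-th of
  countably many interleaved sequences.\<close>

lemma continuous_on_reindex:
  fixes h :: "'i \<Rightarrow> 'j"
  shows "continuous_on UNIV (\<lambda>p :: 'z::topological_space \<times> ('j \<Rightarrow> 'b::topological_space). (fst p, \<lambda>i. snd p (h i)))"
proof (intro continuous_on_Pair continuous_on_fst continuous_on_id continuous_on_coordinatewise_then_product)
  fix i
  show "continuous_on UNIV (\<lambda>p :: 'z \<times> ('j \<Rightarrow> 'b). snd p (h i))"
    by (rule continuous_on_compose2[OF continuous_on_product_coordinates continuous_on_snd])
       (auto intro: continuous_on_id)
qed

lemma continuous_on_snd_component:
  "continuous_on UNIV (\<lambda>p :: 'z::topological_space \<times> ('j \<Rightarrow> 'b::topological_space). snd p i)"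
  by (rule continuous_on_compose2[OF continuous_on_product_coordinates continuous_on_snd])
     (auto intro: continuous_on_id)

lemma analytic_set_closed: "closed C \<Longrightarrow> analytic_set C"
  unfolding analytic_set_def by (intro exI[of _ "C \<times> UNIV"]) (auto simp: closed_Times)

text \<open>The first entry of a witness names an index \<open>n\<close>, and its tail is a witness
  for \<open>A n\<close>. Fixing an entry is a clopen condition, so the combined set is
  closed.\<close>

lemma analytic_set_UN:
  assumes "\<And>n::nat. analytic_set (A n)"
  shows "analytic_set (\<Union>n. A n)"
proof -
  obtain D where D: "\<And>n. closed (D n :: ('a \<times> (nat \<Rightarrow> nat)) set)" "\<And>n. A n = fst ` D n"
    using assms unfolding analytic_set_def by metis
  let ?g = "\<lambda>p :: 'a \<times> (nat \<Rightarrow> nat). (fst p, \<lambda>i. snd p (Suc i))"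
  let ?D = "\<Inter>n. ({p :: 'a \<times> (nat \<Rightarrow> nat). snd p 0 \<noteq> n} \<union> ?g -` D n)"
  have "closed {p :: 'a \<times> (nat \<Rightarrow> nat). snd p 0 \<noteq> n}" for n
  proof -
    have "closed ((\<lambda>p :: 'a \<times> (nat \<Rightarrow> nat). snd p 0) -` (- {n}))"
      by (rule closed_vimage[OF _ continuous_on_snd_component])
         (simp add: closed_def open_discrete)
    then show ?thesis by (simp add: vimage_def)
  qed
  moreover have "closed (?g -` D n)" for n
    by (rule closed_vimage[OF D(1) continuous_on_reindex])
  ultimately have "closed ?D" by (intro closed_INT ballI closed_Un) auto
  moreover have "(\<Union>n. A n) = fst ` ?D"
  proof (intro set_eqI iffI)
    fix z assume "z \<in> (\<Union>n. A n)"
    then obtain n \<alpha> where "(z, \<alpha>) \<in> D n" using D(2) by auto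
    then have "(z, case_nat n \<alpha>) \<in> ?D" by auto
    then show "z \<in> fst ` ?D" by (rule rev_image_eqI) simp
  next
    fix z assume "z \<in> fst ` ?D"
    then obtain p where p: "p \<in> ?D" and z: "z = fst p" by (rule imageE)
    from p have "?g p \<in> D (snd p 0)" by blast
    then have "z \<in> A (snd p 0)" unfolding D(2) by (rule rev_image_eqI) (simp add: z)
    then show "z \<in> (\<Union>n. A n)" by blast
  qed
  ultimately show ?thesis unfolding analytic_set_def by blast
qed

text \<open>One sequence stores a witness for every \<open>A n\<close> at once, by the pairing
  function.\<close>

lemma analytic_set_INT:
  assumes "\<And>n::nat. analytic_set (A n)"
  shows "analytic_set (\<Inter>n. A n)"
proof -
  obtain D where D: "\<And>n. closed (D n :: ('a \<times> (nat \<Rightarrow> nat)) set)" "\<And>n. A n = fst ` D n"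
    using assms unfolding analytic_set_def by metis
  let ?g = "\<lambda>n (p :: 'a \<times> (nat \<Rightarrow> nat)). (fst p, \<lambda>i. snd p (prod_encode (n, i)))"
  let ?D = "\<Inter>n. ?g n -` D n"
  have "closed ?D"
    by (intro closed_INT ballI closed_vimage[OF D(1) continuous_on_reindex])
  moreover have "(\<Inter>n. A n) = fst ` ?D"
  proof (intro set_eqI iffI)
    fix z assume "z \<in> (\<Inter>n. A n)"
    then have "\<forall>n. \<exists>\<alpha>. (z, \<alpha>) \<in> D n" using D(2) by fastforce
    then obtain \<alpha> where "\<And>n. (z, \<alpha> n) \<in> D n" by metis
    then have "(z, \<lambda>k. case prod_decode k of (n, i) \<Rightarrow> \<alpha> n i) \<in> ?D" by auto
    then show "z \<in> fst ` ?D" by (rule rev_image_eqI) simp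
  next
    fix z assume "z \<in> fst ` ?D"
    then obtain p where p: "p \<in> ?D" and z: "z = fst p" by (rule imageE)
    from p have "?g n p \<in> D n" for n by blast
    then have "z \<in> A n" for n unfolding D(2) by (rule rev_image_eqI) (simp add: z)
    then show "z \<in> (\<Inter>n. A n)" by blast
  qed
  ultimately show ?thesis unfolding analytic_set_def by blast
qed

text \<open>Analytic sets are not closed under complements, so the induction carries a set and its
  complement together. It starts because open sets of a metric space are countable unions of closed
  sets.\<close>

lemma analytic_set_borel:
  fixes C :: "'z::metric_space set"
  assumes "C \<in> sets borel"
  shows "analytic_set C"
proof -
  have op: "analytic_set U" if "open U" for U :: "'z set"
  proof -
    have "fsigma_in euclidean U"
      using that by (simp add: open_imp_fsigma_in metrizable_space_euclidean)
    then obtain F :: "nat \<Rightarrow> 'z set" where F: "\<And>n. closed (F n)" "(\<Union>n. F n) = U"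
      unfolding fsigma_in_ascending by auto
    show ?thesis using analytic_set_UN[of F] F analytic_set_closed by metis
  qed
  have "C \<in> sigma_sets UNIV {S. open S}" using assms by (simp add: borel_def)
  then have "analytic_set C \<and> analytic_set (- C)"
  proof induction
    case (Basic a) then show ?case by (auto simp: op intro!: analytic_set_closed)
  next
    case Empty show ?case by (simp add: analytic_set_closed)
  next
    case (Compl a) then show ?case by (simp add: Compl_eq_Diff_UNIV[symmetric])
  next
    case (Union a)
    then show ?case using analytic_set_UN[of a] analytic_set_INT[of "\<lambda>n. - a n"] by simp
  qed
  then show ?thesis by simp
qed

section \<open>Capacitability of projections of Borel sets\<close>

text \<open>Outer measure is continuous along increasing sequences of arbitrary sets, so no
  measurability of the projections is asked for.\<close>

lemma outer_measure_of_bounded_part: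
  fixes b :: "'t \<Rightarrow> nat"
  assumes "space m = UNIV" "r < outer_measure_of m (\<pi> ` T)"
  shows "\<exists>j. r < outer_measure_of m (\<pi> ` {z \<in> T. b z \<le> j})"
proof -
  let ?S = "\<lambda>j. \<pi> ` {z \<in> T. b z \<le> j}"
  have "(SUP j. outer_measure_of m (?S j)) = outer_measure_of m (\<Union>j. ?S j)"
    by (rule SUP_outer_measure_of_incseq) (auto simp: assms incseq_def)
  moreover have "(\<Union>j. ?S j) = \<pi> ` T" by auto
  ultimately have "r < (SUP j. outer_measure_of m (?S j))" using assms(2) by simp
  then show ?thesis by (auto simp: less_SUP_iff)
qed

lemma compact_bounded_functions:
  fixes n :: "nat \<Rightarrow> nat"
  shows "compact {\<beta>. \<forall>i. \<beta> i \<le> n i}"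
proof -
  have "compactin (product_topology (\<lambda>_. euclidean) UNIV) (PiE UNIV (\<lambda>i. {..n i}))"
    by (subst compactin_PiE) (auto simp: finite_imp_compact)
  moreover have "PiE UNIV (\<lambda>i. {..n i}) = {\<beta>. \<forall>i. \<beta> i \<le> n i}"
    by (auto simp: PiE_def Pi_def)
  ultimately show ?thesis by (simp add: euclidean_product_topology)
qed

lemma tendsto_fun_iff:
  fixes f :: "'i \<Rightarrow> 'k \<Rightarrow> 'b::topological_space"
  shows "(f \<longlongrightarrow> l) F \<longleftrightarrow> (\<forall>k. ((\<lambda>i. f i k) \<longlongrightarrow> l k) F)"
  using limitin_componentwise[of "\<lambda>_. euclidean" UNIV f l F]
  by (simp add: euclidean_product_topology)

text \<open>A point in all the closures is a limit of projections of points of \<open>D\<close> with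
  more and more bounded entries. These subconverge, and closedness of \<open>D\<close> keeps the
  limit in \<open>D\<close> with every entry bounded.\<close>

lemma closure_proj_bounded_parts:
  fixes D :: "(('x::euclidean_space \<times> 'w::euclidean_space) \<times> (nat \<Rightarrow> nat)) set"
  assumes D: "closed D"
    and p: "\<And>k. p \<in> closure ((\<lambda>z. fst (fst z)) ` {z \<in> D. norm (fst z) \<le> R \<and> (\<forall>i<k. snd z i \<le> n i)})"
  shows "\<exists>z\<in>D. fst (fst z) = p \<and> norm (fst z) \<le> R \<and> (\<forall>i. snd z i \<le> n i)"
proof -
  have "\<exists>z. z \<in> D \<and> norm (fst z) \<le> R \<and> (\<forall>i<k. snd z i \<le> n i) \<and> dist (fst (fst z)) p < inverse (Suc k)" for k
  proof -
    obtain q where "q \<in> (\<lambda>z. fst (fst z)) ` {z \<in> D. norm (fst z) \<le> R \<and> (\<forall>i<k. snd z i \<le> n i)}"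
      "dist q p < inverse (Suc k)"
      using p[of k] unfolding closure_approachable
      by (meson inverse_positive_iff_positive of_nat_0_less_iff zero_less_Suc)
    then show ?thesis by blast
  qed
  then have "\<exists>z. \<forall>k. z k \<in> D \<and> norm (fst (z k)) \<le> R \<and> (\<forall>i<k. snd (z k) i \<le> n i)
      \<and> dist (fst (fst (z k))) p < inverse (Suc k)"
    by (intro choice allI)
  then obtain z where zz: "\<forall>k. z k \<in> D \<and> norm (fst (z k)) \<le> R \<and> (\<forall>i<k. snd (z k) i \<le> n i)
      \<and> dist (fst (fst (z k))) p < inverse (Suc k)"
    by (rule exE)
  then have z: "\<And>k. z k \<in> D" "\<And>k. norm (fst (z k)) \<le> R"
     "\<And>k i. i < k \<Longrightarrow> snd (z k) i \<le> n i" and d: "\<And>k. dist (fst (fst (z k))) p < inverse (Suc k)"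
    by simp_all
  \<comment> \<open>Entries not yet bounded are reset to 0, which places \<open>y k\<close> in the
    compact set \<open>?K\<close>. Any fixed entry is unaffected once \<open>k\<close> exceeds its
    index, so limits of \<open>y\<close> are limits of \<open>z\<close>.\<close>
  define y where "y k = (fst (z k), \<lambda>i. if i < k then snd (z k) i else 0)" for k
  let ?K = "cball 0 R \<times> {\<beta>. \<forall>i. \<beta> i \<le> n i} :: (('x \<times> 'w) \<times> (nat \<Rightarrow> nat)) set"
  have "seq_compact ?K"
    by (intro compact_imp_seq_compact compact_Times compact_bounded_functions compact_cball)
  moreover have "y k \<in> ?K" for k using z by (auto simp: y_def)
  ultimately obtain l r where l: "l \<in> ?K" and r: "strict_mono r" and lim: "(y \<circ> r) \<longlonglongrightarrow> l"
    using seq_compactE[of ?K y] by blast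
  have 1: "(\<lambda>k. fst (z (r k))) \<longlonglongrightarrow> fst l"
    using tendsto_fst[OF lim] by (simp add: y_def o_def)
  have "(\<lambda>k. snd (z (r k)) i) \<longlonglongrightarrow> snd l i" for i
  proof -
    have "(\<lambda>k. snd (y (r k)) i) \<longlonglongrightarrow> snd l i"
      using tendsto_snd[OF lim] by (simp add: tendsto_fun_iff o_def)
    moreover have "eventually (\<lambda>k. snd (y (r k)) i = snd (z (r k)) i) sequentially"
      using eventually_gt_at_top[of i]
    proof eventually_elim
      case (elim k)
      then have "i < r k" using seq_suble[OF r, of k] by simp
      then show ?case by (simp add: y_def)
    qed
    ultimately show ?thesis by (rule Lim_transform_eventually)
  qed
  then have "(\<lambda>k. snd (z (r k))) \<longlonglongrightarrow> snd l" by (simp add: tendsto_fun_iff)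
  with 1 have "(\<lambda>k. z (r k)) \<longlonglongrightarrow> l"
    using tendsto_Pair[of "\<lambda>k. fst (z (r k))" "fst l" sequentially "\<lambda>k. snd (z (r k))" "snd l"] by simp
  then have lD: "l \<in> D" by (rule closed_sequentially[OF D, rotated]) (simp add: z)
  have "(\<lambda>k. fst (fst (z k))) \<longlonglongrightarrow> p"
  proof (rule metric_tendsto_imp_tendsto[OF LIMSEQ_inverse_real_of_nat])
    show "eventually (\<lambda>k. dist (fst (fst (z k))) p \<le> dist (inverse (real (Suc k))) 0) sequentially"
      using d by (auto intro!: always_eventually less_imp_le simp del: of_nat_Suc)
  qed
  then have "(\<lambda>k. fst (fst (z (r k)))) \<longlonglongrightarrow> p"
    using LIMSEQ_subseq_LIMSEQ[OF _ r] by (simp add: o_def)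
  with tendsto_fst[OF 1] have "fst (fst l) = p" using LIMSEQ_unique by blast
  with l lD show ?thesis by (intro bexI[of _ l]) (auto simp: mem_Times_iff)
qed

text \<open>Capacitability: the coordinates of the witnesses are bounded one at a time, losing
  arbitrarily little outer measure at each step; the bounds together cut out a compact set.\<close>

lemma compact_inner_approximation:
  fixes C :: "('x::euclidean_space \<times> 'w::euclidean_space) set"
  assumes m: "finite_measure m" "sets m = sets borel" and C: "C \<in> sets borel"
    and pos: "outer_measure_of m (fst ` C) > 0"
  shows "\<exists>Q\<subseteq>C. compact Q \<and> emeasure m (fst ` Q) > 0"
proof -
  interpret finite_measure m by fact
  have sp: "space m = UNIV" using sets_eq_imp_space_eq[OF m(2)] by simp
  obtain D :: "(('x \<times> 'w) \<times> (nat \<Rightarrow> nat)) set" where D: "closed D" "C = fst ` D"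
    using analytic_set_borel[OF C] unfolding analytic_set_def by blast
  let ?\<pi> = "\<lambda>z :: ('x \<times> 'w) \<times> (nat \<Rightarrow> nat). fst (fst z)"
  \<comment> \<open>One level \<open>r\<close> is kept strictly below the outer measure through all
    stages, so the limit set still has measure at least \<open>r > 0\<close>.\<close>
  obtain r where r: "0 < r" "r < outer_measure_of m (fst ` C)" using dense[OF pos] by blast
  have "fst ` C = ?\<pi> ` D" using D by (auto simp: image_image)
  with r have "r < outer_measure_of m (?\<pi> ` D)" by simp
  then obtain R where R: "r < outer_measure_of m (?\<pi> ` {z \<in> D. nat \<lceil>norm (fst z)\<rceil> \<le> R})"
    using outer_measure_of_bounded_part[OF sp, of r ?\<pi> D "\<lambda>z. nat \<lceil>norm (fst z)\<rceil>"] by blast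
  let ?D0 = "{z \<in> D. norm (fst z) \<le> real R}"
  have "{z \<in> D. nat \<lceil>norm (fst z)\<rceil> \<le> R} = ?D0"
    by (auto simp: nat_le_iff ceiling_le_iff)
  with R have R0: "r < outer_measure_of m (?\<pi> ` ?D0)" by simp
  \<comment> \<open>Stage \<open>k\<close> bounds entry \<open>k\<close> of the witness;
    \<open>S_eq\<close> below records the resulting closed form.\<close>
  have "\<exists>S. \<forall>k. (r < outer_measure_of m (?\<pi> ` S k) \<and> (k = 0 \<longrightarrow> S k = ?D0)) \<and> (\<exists>j. S (Suc k) = {z \<in> S k. snd z k \<le> j})"
  proof (rule dependent_nat_choice)
    show "\<exists>x. r < outer_measure_of m (?\<pi> ` x) \<and> ((0::nat) = 0 \<longrightarrow> x = ?D0)" using R0 by blast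
  next
    fix x :: "(('x \<times> 'w) \<times> (nat \<Rightarrow> nat)) set" and k :: nat
    assume "r < outer_measure_of m (?\<pi> ` x) \<and> (k = 0 \<longrightarrow> x = ?D0)"
    then obtain j where "r < outer_measure_of m (?\<pi> ` {z \<in> x. snd z k \<le> j})"
      using outer_measure_of_bounded_part[OF sp, of r ?\<pi> x "\<lambda>z. snd z k"] by blast
    then show "\<exists>y. (r < outer_measure_of m (?\<pi> ` y) \<and> (Suc k = 0 \<longrightarrow> y = ?D0)) \<and> (\<exists>j. y = {z \<in> x. snd z k \<le> j})"
      by blast
  qed
  then obtain S where S: "\<And>k. r < outer_measure_of m (?\<pi> ` S k)" "S 0 = ?D0"
      and "\<forall>k. \<exists>j. S (Suc k) = {z \<in> S k. snd z k \<le> j}"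
    by blast
  then obtain n where n: "\<And>k. S (Suc k) = {z \<in> S k. snd z k \<le> n k}"
    using choice[of "\<lambda>k j. S (Suc k) = {z \<in> S k. snd z k \<le> j}"] by blast
  have S_eq: "S k = {z \<in> D. norm (fst z) \<le> real R \<and> (\<forall>i<k. snd z i \<le> n i)}" for k
    by (induction k) (auto simp: S(2) n less_Suc_eq)
  define Q where "Q = fst ` (D \<inter> (cball 0 (real R) \<times> {\<beta>. \<forall>i. \<beta> i \<le> n i}))"
  have "compact (D \<inter> (cball 0 (real R) \<times> {\<beta>. \<forall>i. \<beta> i \<le> n i}))"
    by (intro closed_Int_compact D compact_Times compact_bounded_functions compact_cball)
  then have Q: "compact Q" unfolding Q_def by (intro compact_continuous_image continuous_on_fst continuous_on_id)
  have "(\<Inter>k. closure (?\<pi> ` S k)) \<subseteq> fst ` Q"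
  proof
    fix p assume "p \<in> (\<Inter>k. closure (?\<pi> ` S k))"
    then obtain z where "z \<in> D" "fst (fst z) = p" "norm (fst z) \<le> R" "\<forall>i. snd z i \<le> n i"
      using closure_proj_bounded_parts[OF D(1), of p R n] unfolding S_eq by blast
    then have "fst z \<in> Q" unfolding Q_def by (intro image_eqI[of _ _ z]) (auto simp: mem_Times_iff)
    with \<open>fst (fst z) = p\<close> show "p \<in> fst ` Q" by blast
  qed
  \<comment> \<open>The projections of the \<open>S k\<close> may fail to be Borel. Their closures
    are Borel and decrease, so continuity from above of the finite measure applies to them.\<close>
  moreover have "r \<le> emeasure m (\<Inter>k. closure (?\<pi> ` S k))"
  proof -
    have "(INF k. emeasure m (closure (?\<pi> ` S k))) = emeasure m (\<Inter>k. closure (?\<pi> ` S k))"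
    proof (rule INF_emeasure_decseq)
      show "decseq (\<lambda>k. closure (?\<pi> ` S k))"
        by (rule decseq_SucI) (intro closure_mono image_mono, auto simp: n)
    qed (auto simp: m(2))
    moreover have "r \<le> emeasure m (closure (?\<pi> ` S k))" for k
    proof -
      have "r \<le> outer_measure_of m (?\<pi> ` S k)" using S(1) less_imp_le by blast
      also have "\<dots> \<le> outer_measure_of m (closure (?\<pi> ` S k))"
        by (rule outer_measure_of_mono[OF closure_subset])
      finally show ?thesis by (simp add: m(2))
    qed
    ultimately show ?thesis by (metis INF_greatest)
  qed
  moreover have "fst ` Q \<in> sets m"
    using Q by (auto simp: m(2) intro!: borel_compact compact_continuous_image continuous_on_fst continuous_on_id)
  ultimately have "r \<le> emeasure m (fst ` Q)" by (meson emeasure_mono order_trans)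
  moreover have "Q \<subseteq> C" unfolding Q_def D(2) by blast
  ultimately show ?thesis using Q r by (metis less_le_trans)
qed

section \<open>From compact sets to compact graphs\<close>

lemma compact_inner_measure:
  fixes B :: "'a::{second_countable_topology, complete_space} set"
  assumes "finite_measure M" "sets M = sets borel" "B \<in> sets borel" "e > 0"
  obtains K where "K \<subseteq> B" "compact K" "measure M B \<le> measure M K + e"
proof (cases "measure M B \<le> e")
  case True
  then show ?thesis using that[of "{}"] by simp
next
  case False
  interpret finite_measure M by fact
  have "ennreal (measure M B - e) < emeasure M B"
    using False assms(4) by (simp add: emeasure_eq_measure ennreal_less_iff)
  also have "emeasure M B = (SUP K \<in> {K. K \<subseteq> B \<and> compact K}. emeasure M K)"
    by (rule inner_regular) (auto simp: assms)
  finally obtain K where K: "K \<subseteq> B" "compact K" "ennreal (measure M B - e) < emeasure M K"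
    by (auto simp: less_SUP_iff)
  then have "measure M B - e < measure M K"
    using False by (simp add: emeasure_eq_measure ennreal_less_iff)
  with K show ?thesis using that by simp
qed

lemma compact_fst_image: "compact Q \<Longrightarrow> compact (fst ` Q)"
  by (intro compact_continuous_image continuous_on_fst continuous_on_id)

text \<open>The part of the base that lies below the first ball keeps only that ball; the rest of the base is
  replaced by a compact set of almost the same measure.\<close>

lemma compact_shrink_fibres:
  fixes Q :: "('x::euclidean_space \<times> 'w::euclidean_space) set"
  assumes m: "finite_measure m" "sets m = sets borel" and "finite F"
    and "compact Q" "snd ` Q \<subseteq> (\<Union>c\<in>F. cball c \<delta>)" "e > 0"
  shows "\<exists>Q'\<subseteq>Q. compact Q' \<and> measure m (fst ` Q) \<le> measure m (fst ` Q') + e \<and>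
     (\<forall>p w w'. (p, w) \<in> Q' \<longrightarrow> (p, w') \<in> Q' \<longrightarrow> dist w w' \<le> 2 * \<delta>)"
  using assms(3-)
proof (induction F arbitrary: Q e rule: finite_induct)
  case empty
  then have "Q = {}" by auto
  then show ?case using empty by (intro exI[of _ "{}"]) auto
next
  case (insert c F)
  interpret finite_measure m by fact
  define Q1 where "Q1 = Q \<inter> (UNIV \<times> cball c \<delta>)"
  define P where "P = fst ` Q1"
  have Q1: "compact Q1" unfolding Q1_def
    by (intro compact_Int_closed closed_Times) (auto simp: insert.prems)
  then have P: "compact P" unfolding P_def by (rule compact_fst_image)
  have fQ: "compact (fst ` Q)" using insert.prems(1) by (rule compact_fst_image)
  have "fst ` Q - P \<in> sets borel" by (intro sets.Diff borel_compact P fQ)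
  \<comment> \<open>Half of the allowance \<open>e\<close> is spent on \<open>K\<close>, the other
    half on the induction hypothesis.\<close>
  then obtain K where K: "K \<subseteq> fst ` Q - P" "compact K" "measure m (fst ` Q - P) \<le> measure m K + e / 2"
    using compact_inner_measure[OF m, of "fst ` Q - P" "e / 2"] insert.prems(3) by auto
  define Q2 where "Q2 = Q \<inter> (K \<times> UNIV)"
  have Q2: "compact Q2" unfolding Q2_def
    by (intro compact_Int_closed closed_Times) (auto simp: insert.prems compact_imp_closed K)
  have fQ2: "fst ` Q2 = K"
  proof
    show "fst ` Q2 \<subseteq> K" unfolding Q2_def by auto
    show "K \<subseteq> fst ` Q2"
    proof
      fix p assume "p \<in> K"
      moreover then obtain z where "z \<in> Q" "p = fst z" using K(1) by blast
      ultimately show "p \<in> fst ` Q2" unfolding Q2_def by (intro image_eqI[of _ _ z]) (auto simp: mem_Times_iff)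
    qed
  qed
  have "snd ` Q2 \<subseteq> (\<Union>c\<in>F. cball c \<delta>)"
  proof
    fix w assume "w \<in> snd ` Q2"
    then obtain p where pw: "(p, w) \<in> Q" "p \<in> K" unfolding Q2_def by auto
    then have "w \<in> (\<Union>c\<in>insert c F. cball c \<delta>)" using insert.prems(2) by force
    \<comment> \<open>A point of the first ball would put its base point into \<open>P\<close>, but
      \<open>K\<close> was chosen off \<open>P\<close>. Hence the balls around \<open>F\<close>
      alone cover \<open>Q2\<close>.\<close>
    moreover have "w \<notin> cball c \<delta>"
    proof
      assume "w \<in> cball c \<delta>"
      then have "p \<in> P" using pw(1) unfolding P_def Q1_def by force
      with pw(2) K(1) show False by blast
    qed
    ultimately show "w \<in> (\<Union>c\<in>F. cball c \<delta>)" by auto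
  qed
  then obtain Q2' where Q2': "Q2' \<subseteq> Q2" "compact Q2'" "measure m K \<le> measure m (fst ` Q2') + e / 2"
     "\<forall>p w w'. (p, w) \<in> Q2' \<longrightarrow> (p, w') \<in> Q2' \<longrightarrow> dist w w' \<le> 2 * \<delta>"
    using insert.IH[OF Q2, of "e / 2"] insert.prems(3) unfolding fQ2 by auto
  have f2: "fst ` Q2' \<subseteq> K" using Q2'(1) fQ2 by blast
  \<comment> \<open>The two pieces lie over disjoint bases, so no fibre of their union mixes them;
    this also makes the measures add up.\<close>
  have disj: "P \<inter> fst ` Q2' = {}" using f2 K(1) by blast
  have mP: "P \<in> sets m" "fst ` Q2' \<in> sets m" "fst ` Q \<in> sets m"
    using P compact_fst_image[OF Q2'(2)] fQ by (auto simp: m(2) borel_compact)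
  have "P \<subseteq> fst ` Q" unfolding P_def Q1_def by blast
  then have "measure m (fst ` Q) = measure m P + measure m (fst ` Q - P)"
    using mP finite_measure_Diff by force
  also have "\<dots> \<le> measure m P + measure m (fst ` Q2') + e"
    using K(3) Q2'(3) by simp
  also have "measure m P + measure m (fst ` Q2') = measure m (P \<union> fst ` Q2')"
    using finite_measure_Union[OF mP(1,2) disj] by simp
  also have "P \<union> fst ` Q2' = fst ` (Q1 \<union> Q2')" by (simp add: P_def image_Un)
  finally have le: "measure m (fst ` Q) \<le> measure m (fst ` (Q1 \<union> Q2')) + e" .
  have fib: "dist w w' \<le> 2 * \<delta>" if "(p, w) \<in> Q1 \<union> Q2'" "(p, w') \<in> Q1 \<union> Q2'" for p w w'
  proof (cases "p \<in> P")
    case True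
    then have "(p, w) \<in> Q1" "(p, w') \<in> Q1" using that disj by force+
    then have "dist c w \<le> \<delta>" "dist c w' \<le> \<delta>" by (auto simp: Q1_def)
    then show ?thesis by metric
  next
    case False
    then have "(p, w) \<in> Q2'" "(p, w') \<in> Q2'" using that unfolding P_def by force+
    then show ?thesis using Q2'(4) by blast
  qed
  show ?case
  proof (intro exI[of _ "Q1 \<union> Q2'"] conjI allI impI)
    show "Q1 \<union> Q2' \<subseteq> Q" using Q2'(1) unfolding Q1_def Q2_def by blast
    show "compact (Q1 \<union> Q2')" using Q1 Q2'(2) by (rule compact_Un)
  qed (use le fib in auto)
qed

text \<open>Shrinking the fibres repeatedly, with diameters at most \<open>2 / (k + 1)\<close>,
  leaves single points in the intersection, while the measure of the base never drops below half of
  its initial value.\<close>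

lemma compact_subgraph:
  fixes Q :: "('x::euclidean_space \<times> 'w::euclidean_space) set"
  assumes m: "finite_measure m" "sets m = sets borel" and Q: "compact Q" "measure m (fst ` Q) > 0"
  shows "\<exists>G\<subseteq>Q. compact G \<and> measure m (fst ` G) > 0 \<and> (\<forall>p w w'. (p, w) \<in> G \<longrightarrow> (p, w') \<in> G \<longrightarrow> w = w')"
proof -
  interpret finite_measure m by fact
  define r where "r = measure m (fst ` Q) / 2"
  have r: "0 < r" "r < measure m (fst ` Q)" using Q(2) by (auto simp: r_def)
  have "\<exists>S. \<forall>k. (compact (S k) \<and> r < measure m (fst ` S k) \<and> (k = 0 \<longrightarrow> S k = Q)) \<and>
     (S (Suc k) \<subseteq> S k \<and> (\<forall>p w w'. (p, w) \<in> S (Suc k) \<longrightarrow> (p, w') \<in> S (Suc k) \<longrightarrow> dist w w' \<le> 2 * inverse (real (Suc k))))"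
  proof (rule dependent_nat_choice)
    show "\<exists>x. compact x \<and> r < measure m (fst ` x) \<and> ((0::nat) = 0 \<longrightarrow> x = Q)" using r Q by blast
  next
    fix x :: "('x \<times> 'w) set" and k :: nat
    assume x: "compact x \<and> r < measure m (fst ` x) \<and> (k = 0 \<longrightarrow> x = Q)"
    let ?d = "inverse (real (Suc k))"
    have "compact (snd ` x)" using x by (intro compact_continuous_image continuous_on_snd continuous_on_id) auto
    then obtain F where F: "finite F" "snd ` x \<subseteq> (\<Union>c\<in>F. ball c ?d)"
      using compact_eq_totally_bounded[of "snd ` x"] by (metis inverse_positive_iff_positive of_nat_0_less_iff zero_less_Suc)
    then have "snd ` x \<subseteq> (\<Union>c\<in>F. cball c ?d)" using ball_subset_cball by blast
    \<comment> \<open>Giving up half of the excess over \<open>r\<close> keeps the measure strictly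
      above \<open>r\<close>.\<close>
    then obtain Q' where Q': "Q' \<subseteq> x" "compact Q'" "measure m (fst ` x) \<le> measure m (fst ` Q') + (measure m (fst ` x) - r) / 2"
      "\<forall>p w w'. (p, w) \<in> Q' \<longrightarrow> (p, w') \<in> Q' \<longrightarrow> dist w w' \<le> 2 * ?d"
      using compact_shrink_fibres[OF m F(1), of x ?d "(measure m (fst ` x) - r) / 2"] x by auto
    have "r < measure m (fst ` Q')" using Q'(3) x by (simp add: field_simps)
    then show "\<exists>y. (compact y \<and> r < measure m (fst ` y) \<and> (Suc k = 0 \<longrightarrow> y = Q)) \<and> y \<subseteq> x \<and>
      (\<forall>p w w'. (p, w) \<in> y \<longrightarrow> (p, w') \<in> y \<longrightarrow> dist w w' \<le> 2 * ?d)"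
      using Q' by (intro exI[of _ Q']) auto
  qed
  then obtain S where SS: "\<forall>k. (compact (S k) \<and> r < measure m (fst ` S k) \<and> (k = 0 \<longrightarrow> S k = Q)) \<and>
     (S (Suc k) \<subseteq> S k \<and> (\<forall>p w w'. (p, w) \<in> S (Suc k) \<longrightarrow> (p, w') \<in> S (Suc k) \<longrightarrow> dist w w' \<le> 2 * inverse (real (Suc k))))"
    by (rule exE)
  then have S: "\<And>k. compact (S k)" "\<And>k. r < measure m (fst ` S k)" "S 0 = Q" "\<And>k. S (Suc k) \<subseteq> S k"
    by simp_all
  have fib: "dist w w' \<le> 2 * inverse (real (Suc k))" if "(p, w) \<in> S (Suc k)" "(p, w') \<in> S (Suc k)" for k p w w'
    using SS that by blast
  have dec: "S j \<subseteq> S i" if "i \<le> j" for i j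
    using lift_Suc_antimono_le[of S, OF S(4) that] .
  define G where "G = (\<Inter>k. S k)"
  have G: "compact G" 
  proof -
    have "closed G" unfolding G_def by (intro closed_INT ballI compact_imp_closed S)
    moreover have "G = S 0 \<inter> G" unfolding G_def by blast
    ultimately show ?thesis using compact_Int_closed[OF S(1)] by metis
  qed
  have "w = w'" if "(p, w) \<in> G" "(p, w') \<in> G" for p w w'
  proof -
    have "dist w w' \<le> 2 * inverse (real (Suc k))" for k
      using that fib[of p w k w'] unfolding G_def by blast
    moreover have "(\<lambda>k. 2 * inverse (real (Suc k))) \<longlonglongrightarrow> 2 * 0"
      by (intro tendsto_mult_left LIMSEQ_inverse_real_of_nat)
    ultimately have "dist w w' \<le> 2 * 0" 
      using LIMSEQ_le_const[of "\<lambda>k. 2 * inverse (real (Suc k))" "2 * 0" "dist w w'"] by blast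
    then show ?thesis by simp
  qed
  \<comment> \<open>Projection commutes with this decreasing intersection because the fibres over a
    fixed \<open>p\<close> are nested nonempty compact sets.\<close>
  moreover have "fst ` G = (\<Inter>k. fst ` S k)"
  proof
    show "fst ` G \<subseteq> (\<Inter>k. fst ` S k)" unfolding G_def by blast
    show "(\<Inter>k. fst ` S k) \<subseteq> fst ` G"
    proof
      fix p assume p: "p \<in> (\<Inter>k. fst ` S k)"
      have "\<Inter>(range (\<lambda>k. S k \<inter> ({p} \<times> UNIV))) \<noteq> {}"
      proof (rule compact_nest)
        show "compact (S k \<inter> ({p} \<times> UNIV))" for k
          by (intro compact_Int_closed closed_Times S) auto
        show "S k \<inter> ({p} \<times> UNIV) \<noteq> {}" for k
        proof -
          have "p \<in> fst ` S k" using p by blast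
          then obtain z where "z \<in> S k" "p = fst z" by (rule imageE)
          then have "z \<in> S k \<inter> ({p} \<times> UNIV)" by (simp add: mem_Times_iff)
          then show ?thesis by blast
        qed
        show "S j \<inter> ({p} \<times> UNIV) \<subseteq> S i \<inter> ({p} \<times> UNIV)" if "i \<le> j" for i j
          using dec[OF that] by blast
      qed
      then obtain z where z: "\<And>k. z \<in> S k \<inter> ({p} \<times> UNIV)" by blast
      then have "z \<in> G" "fst z = p" unfolding G_def by (blast, auto simp: mem_Times_iff)
      then show "p \<in> fst ` G" by blast
    qed
  qed
  moreover have "r \<le> measure m (\<Inter>k. fst ` S k)"
  proof -
    have "(\<lambda>k. measure m (fst ` S k)) \<longlonglongrightarrow> measure m (\<Inter>k. fst ` S k)"
    proof (rule finite_Lim_measure_decseq)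
      show "range (\<lambda>k. fst ` S k) \<subseteq> sets m"
        using compact_fst_image[OF S(1)] by (auto simp: m(2) borel_compact)
      show "decseq (\<lambda>k. fst ` S k)" by (intro decseq_SucI image_mono S)
    qed
    then show ?thesis by (rule LIMSEQ_le_const) (auto intro: less_imp_le S)
  qed
  moreover have "G \<subseteq> Q" unfolding G_def using S(3) by blast
  ultimately show ?thesis using G r by (intro exI[of _ G]) auto
qed

text \<open>On a compact graph \<open>fst\<close> is a continuous injection, so its inverse is
  continuous, and the second component of that inverse is the selection. The hypothesis
  \<open>nn\<close> speaks of null covers because the projection of a Borel set need not be
  Borel.\<close>

lemma continuous_selection_on_compact:
  fixes C :: "('x::euclidean_space \<times> 'w::euclidean_space) set"
  assumes m: "finite_measure m" "sets m = sets borel" and C: "C \<in> sets borel"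
    and nn: "\<not> (\<exists>N\<in>null_sets m. fst ` C \<subseteq> N)"
  obtains P w where "compact P" "measure m P > 0" "continuous_on P w" "\<And>p. p \<in> P \<Longrightarrow> (p, w p) \<in> C"
proof -
  interpret finite_measure m by fact
  have sp: "space m = UNIV" using sets_eq_imp_space_eq[OF m(2)] by simp
  have "outer_measure_of m (fst ` C) > 0"
  proof (rule ccontr)
    assume "\<not> ?thesis"
    then have "outer_measure_of m (fst ` C) = 0" by simp
    moreover obtain E where "E \<in> sets m" "fst ` C \<subseteq> E" "outer_measure_of m (fst ` C) = emeasure m E"
      using outer_measure_of_attain[of "fst ` C" m] sp by auto
    ultimately show False using nn by (auto simp: null_sets_def)
  qed
  then obtain Q where Q: "Q \<subseteq> C" "compact Q" "emeasure m (fst ` Q) > 0"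
    using compact_inner_approximation[OF m C] by blast
  then have "measure m (fst ` Q) > 0" by (simp add: emeasure_eq_measure)
  then obtain G where G: "G \<subseteq> Q" "compact G" "measure m (fst ` G) > 0"
     and graph: "\<And>p w w'. (p, w) \<in> G \<Longrightarrow> (p, w') \<in> G \<Longrightarrow> w = w'"
    using compact_subgraph[OF m Q(2)] by blast
  have inj: "inj_on fst G"
  proof (rule inj_onI)
    fix a b assume "a \<in> G" "b \<in> G" "fst a = fst b"
    moreover have "snd a = snd b"
      using graph[of "fst a" "snd a" "snd b"] calculation by (metis prod.collapse)
    ultimately show "a = b" by (simp add: prod_eq_iff)
  qed
  have cont: "continuous_on (fst ` G) (inv_into G fst)"
    by (rule continuous_on_inv) (auto simp: G inj intro: continuous_intros)
  show ?thesis
  proof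
    show "compact (fst ` G)" using G(2) by (rule compact_fst_image)
    show "measure m (fst ` G) > 0" by fact
    show "continuous_on (fst ` G) (\<lambda>p. snd (inv_into G fst p))" using cont by (rule continuous_on_snd)
    show "(p, snd (inv_into G fst p)) \<in> C" if "p \<in> fst ` G" for p
    proof -
      have "inv_into G fst p \<in> G" "fst (inv_into G fst p) = p"
        using that by (rule inv_into_into, rule f_inv_into_f)
      then show ?thesis using G(1) Q(1) by (metis prod.collapse subsetD)
    qed
  qed
qed

section \<open>Perturbation of compactly supported Radon measures\<close>

definition plus_measure :: "'a measure \<Rightarrow> 'a measure \<Rightarrow> 'a measure" where
  "plus_measure M N = measure_of (space M) (sets M) (\<lambda>A. emeasure M A + emeasure N A)"

lemma space_plus_measure [simp]: "space (plus_measure M N) = space M"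
  by (simp add: plus_measure_def)

lemma sets_plus_measure [simp, measurable_cong]: "sets (plus_measure M N) = sets M"
  by (simp add: plus_measure_def)

lemma emeasure_plus_measure:
  assumes "sets N = sets M" "A \<in> sets M"
  shows "emeasure (plus_measure M N) A = emeasure M A + emeasure N A"
proof -
  have "emeasure (measure_of (space M) (sets M) (\<lambda>A. emeasure M A + emeasure N A)) A = emeasure M A + emeasure N A"
  proof (rule emeasure_measure_of_sigma)
    show "sigma_algebra (space M) (sets M)" by (rule sets.sigma_algebra_axioms)
    show "positive (sets M) (\<lambda>A. emeasure M A + emeasure N A)" by (simp add: positive_def)
    show "countably_additive (sets M) (\<lambda>A. emeasure M A + emeasure N A)"
      using assms by (auto simp: countably_additive_def suminf_add[symmetric] suminf_emeasure)
  qed fact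
  then show ?thesis by (simp add: plus_measure_def)
qed

lemma nn_integral_plus_measure:
  assumes "sets N = sets M" "f \<in> borel_measurable M"
  shows "(\<integral>\<^sup>+ x. f x \<partial>plus_measure M N) = (\<integral>\<^sup>+ x. f x \<partial>M) + (\<integral>\<^sup>+ x. f x \<partial>N)"
proof -
  note [measurable_cong] = assms(1)
  have sp: "space N = space M" using assms(1) by (rule sets_eq_imp_space_eq)
  from assms(2) show ?thesis
  proof induct
    case (cong f g)
    moreover have "(\<integral>\<^sup>+ x. f x \<partial>plus_measure M N) = (\<integral>\<^sup>+ x. g x \<partial>plus_measure M N)"
      "(\<integral>\<^sup>+ x. f x \<partial>M) = (\<integral>\<^sup>+ x. g x \<partial>M)" "(\<integral>\<^sup>+ x. f x \<partial>N) = (\<integral>\<^sup>+ x. g x \<partial>N)"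
      using cong(3) by (auto intro!: nn_integral_cong simp: sp)
    ultimately show ?case by simp
  next
    case (set A)
    then show ?case using assms(1) by (simp add: emeasure_plus_measure)
  next
    case (mult u c)
    note [measurable] = mult(2)
    show ?case using mult by (simp add: nn_integral_cmult distrib_left)
  next
    case (add u v)
    note [measurable] = add(1) add(4)
    show ?case using add by (simp add: nn_integral_add ac_simps)
  next
    case (seq U)
    note [measurable] = seq(1)
    have inc: "incseq (\<lambda>i. \<integral>\<^sup>+ x. U i x \<partial>M')" for M'
      using seq(4) by (auto simp: incseq_def le_fun_def intro!: nn_integral_mono)
    have "(SUP i. \<integral>\<^sup>+ x. U i x \<partial>plus_measure M N) = (SUP i. \<integral>\<^sup>+ x. U i x \<partial>M) + (SUP i. \<integral>\<^sup>+ x. U i x \<partial>N)"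
      using seq by (simp add: ennreal_SUP_add[OF inc inc])
    then show ?case
      using seq(4) by (simp add: nn_integral_monotone_convergence_SUP image_image)
  qed
qed

lemma integrable_plus_measure:
  fixes f :: "'a \<Rightarrow> real"
  assumes "sets N = sets M"
  shows "integrable (plus_measure M N) f \<longleftrightarrow> integrable M f \<and> integrable N f"
proof -
  have "f \<in> borel_measurable N \<longleftrightarrow> f \<in> borel_measurable M"
    using measurable_cong_sets[OF assms refl] by blast
  moreover have "f \<in> borel_measurable (plus_measure M N) \<longleftrightarrow> f \<in> borel_measurable M"
    using measurable_cong_sets[OF sets_plus_measure refl] by blast
  ultimately show ?thesis
    by (cases "f \<in> borel_measurable M") (simp_all add: integrable_iff_bounded nn_integral_plus_measure[OF assms] ennreal_add_eq_top less_top)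
qed

lemma integral_plus_measure:
  fixes f :: "'a \<Rightarrow> real"
  assumes "sets N = sets M" "integrable M f" "integrable N f"
  shows "(\<integral>x. f x \<partial>plus_measure M N) = (\<integral>x. f x \<partial>M) + (\<integral>x. f x \<partial>N)"
proof -
  have i: "integrable (plus_measure M N) f" using assms by (simp add: integrable_plus_measure)
  have fm: "f \<in> borel_measurable M" using assms(2) by simp
  have fin: "(\<integral>\<^sup>+ x. ennreal (f x) \<partial>M') < \<infinity>" "(\<integral>\<^sup>+ x. ennreal (- f x) \<partial>M') < \<infinity>" if "integrable M' f" for M'
    using that by (auto simp: real_integrable_def less_top)
  show ?thesis
    using fin[OF assms(2)] fin[OF assms(3)] fm
    by (simp add: real_lebesgue_integral_def i assms(2,3) nn_integral_plus_measure[OF assms(1)] enn2real_plus)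
qed

section \<open>Borel sets of an abstract topology\<close>

lemma space_borel_of [simp]: "space (borel_of X) = topspace X"
  unfolding borel_of_def by (rule space_measure_of) (auto dest: openin_subset)

lemma sets_borel_of: "sets (borel_of X) = sigma_sets (topspace X) {U. openin X U}"
  unfolding borel_of_def by (rule sets_measure_of) (auto dest: openin_subset)

lemma borel_of_openin: "openin X U \<Longrightarrow> U \<in> sets (borel_of X)"
  unfolding sets_borel_of by blast

lemma borel_of_closedin:
  assumes "closedin X C"
  shows "C \<in> sets (borel_of X)"
proof -
  have "space (borel_of X) - (topspace X - C) \<in> sets (borel_of X)"
    by (intro sets.Diff borel_of_openin) (use assms in auto)
  moreover have "space (borel_of X) - (topspace X - C) = C"
    using closedin_subset[OF assms] by auto
  ultimately show ?thesis by simp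
qed

lemma borel_of_compactin: "Hausdorff_space X \<Longrightarrow> compactin X K \<Longrightarrow> K \<in> sets (borel_of X)"
  by (intro borel_of_closedin compactin_imp_closedin)

lemma sets_borel_of_euclidean: "sets (borel_of euclidean) = sets borel"
  by (simp add: sets_borel_of borel_def)

text \<open>Covers maps that are continuous only on a subset, such as the transports on a compact
  set and the coordinates of one chart: preimages of open sets are traces of open sets.\<close>

lemma measurable_restrict_borel_of:
  assumes f: "continuous_map (subtopology X K) Y f"
  shows "f \<in> restrict_space (borel_of X) K \<rightarrow>\<^sub>M borel_of Y"
proof (unfold borel_of_def[of Y], rule measurable_measure_of)
  show "{U. openin Y U} \<subseteq> Pow (topspace Y)" by (auto dest: openin_subset)
  show "f \<in> space (restrict_space (borel_of X) K) \<rightarrow> topspace Y"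
    using f by (auto simp: space_restrict_space continuous_map_def Pi_def)
  fix U assume "U \<in> {U. openin Y U}"
  then have "openin (subtopology X K) {x \<in> topspace (subtopology X K). f x \<in> U}"
    using f by (auto simp: continuous_map_def)
  then obtain V where V: "openin X V" "{x \<in> topspace (subtopology X K). f x \<in> U} = V \<inter> K"
    unfolding openin_subtopology by blast
  have "f -` U \<inter> space (restrict_space (borel_of X) K) = {x \<in> topspace (subtopology X K). f x \<in> U}"
    by (auto simp: space_restrict_space)
  also have "\<dots> = K \<inter> V" using V(2) by auto
  finally show "f -` U \<inter> space (restrict_space (borel_of X) K) \<in> sets (restrict_space (borel_of X) K)"
    using borel_of_openin[OF V(1)] by (auto simp: sets_restrict_space)
qed

lemma measurable_borel_of:
  assumes f: "continuous_map X Y f"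
  shows "f \<in> borel_of X \<rightarrow>\<^sub>M borel_of Y"
proof (unfold borel_of_def[of Y], rule measurable_measure_of)
  show "{U. openin Y U} \<subseteq> Pow (topspace Y)" by (auto dest: openin_subset)
  show "f \<in> space (borel_of X) \<rightarrow> topspace Y"
    using f by (auto simp: continuous_map_def Pi_def)
  fix U assume "U \<in> {U. openin Y U}"
  then have "openin X {x \<in> topspace X. f x \<in> U}"
    using f by (auto simp: continuous_map_def)
  moreover have "f -` U \<inter> space (borel_of X) = {x \<in> topspace X. f x \<in> U}" by auto
  ultimately show "f -` U \<inter> space (borel_of X) \<in> sets (borel_of X)"
    using borel_of_openin by metis
qed

section \<open>Inner regularity under sums and push-forwards\<close>

text \<open>Inner regularity of a finite measure in epsilon form, which passes to sums and images
  more easily than a supremum. In a Hausdorff space it implies \<open>radon_measure\<close> and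
  follows from membership in \<open>compact_radon\<close>.\<close>

definition compact_regular :: "'a topology \<Rightarrow> 'a measure \<Rightarrow> bool" where
  "compact_regular X N \<longleftrightarrow> finite_measure N \<and> sets N = sets (borel_of X) \<and>
     (\<forall>A\<in>sets N. \<forall>e>0. \<exists>K. compactin X K \<and> K \<subseteq> A \<and> measure N A \<le> measure N K + e)"

lemma compact_regular_imp_radon:
  assumes "Hausdorff_space X" "compact_regular X N"
  shows "radon_measure X N"
proof -
  interpret finite_measure N using assms by (simp add: compact_regular_def)
  have sets: "sets N = sets (borel_of X)" using assms by (simp add: compact_regular_def)
  have sp: "space N = topspace X" using sets_eq_imp_space_eq[OF sets] by simp
  have "emeasure N A = (SUP K\<in>{K. compactin X K \<and> K \<in> sets N \<and> K \<subseteq> A}. emeasure N K)" if A: "A \<in> sets N" for A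
  proof (rule ennreal_approx_SUP)
    show "emeasure N K \<le> emeasure N A" if "K \<in> {K. compactin X K \<and> K \<in> sets N \<and> K \<subseteq> A}" for K
      using that A by (auto intro: emeasure_mono)
    show "\<exists>K\<in>{K. compactin X K \<and> K \<in> sets N \<and> K \<subseteq> A}. emeasure N A \<le> emeasure N K + ennreal e"
      if e: "0 < e" for e
    proof -
      obtain K where K: "compactin X K" "K \<subseteq> A" "measure N A \<le> measure N K + e"
        using assms(2) A e unfolding compact_regular_def by blast
      have "K \<in> sets N" using borel_of_compactin[OF assms(1) K(1)] by (simp add: sets)
      moreover have "emeasure N A \<le> emeasure N K + ennreal e"
        using K(3) e by (simp add: emeasure_eq_measure ennreal_plus[symmetric] del: ennreal_plus)
      ultimately show ?thesis using K by blast
    qed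
  qed
  moreover have "emeasure N K < \<infinity>" for K by (simp add: less_top[symmetric])
  ultimately show ?thesis unfolding radon_measure_def using sets sp by blast
qed

lemma compact_regular_plus:
  assumes "Hausdorff_space X" "compact_regular X M" "compact_regular X N"
  shows "compact_regular X (plus_measure M N)"
proof -
  interpret M: finite_measure M using assms by (simp add: compact_regular_def)
  interpret N: finite_measure N using assms by (simp add: compact_regular_def)
  have sM: "sets M = sets (borel_of X)" and sN: "sets N = sets (borel_of X)"
    using assms by (auto simp: compact_regular_def)
  then have sNM: "sets N = sets M" by simp
  have fin: "finite_measure (plus_measure M N)"
    using sNM by (intro finite_measureI)
      (simp add: emeasure_plus_measure M.emeasure_eq_measure N.emeasure_eq_measure)
  have m: "measure (plus_measure M N) A = measure M A + measure N A" if "A \<in> sets M" for A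
    using emeasure_plus_measure[OF sNM that]
    by (simp add: measure_def M.emeasure_finite N.emeasure_finite enn2real_plus less_top[symmetric])
  have "\<exists>K. compactin X K \<and> K \<subseteq> A \<and> measure (plus_measure M N) A \<le> measure (plus_measure M N) K + e"
    if A: "A \<in> sets M" and "e > 0" for A e
  proof -
    obtain K1 where K1: "compactin X K1" "K1 \<subseteq> A" "measure M A \<le> measure M K1 + e / 2"
      using assms(2) A \<open>e > 0\<close> unfolding compact_regular_def by (metis half_gt_zero)
    obtain K2 where K2: "compactin X K2" "K2 \<subseteq> A" "measure N A \<le> measure N K2 + e / 2"
      using assms(3) A \<open>e > 0\<close> sNM unfolding compact_regular_def by (metis half_gt_zero)
    have s: "K1 \<in> sets M" "K2 \<in> sets M"
      using borel_of_compactin[OF assms(1)] K1(1) K2(1) by (auto simp: sM)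
    have "measure M K1 \<le> measure M (K1 \<union> K2)" "measure N K2 \<le> measure N (K1 \<union> K2)"
      using s by (auto intro!: M.finite_measure_mono N.finite_measure_mono simp: sNM)
    then show ?thesis using K1 K2 s A
      by (intro exI[of _ "K1 \<union> K2"]) (auto simp: m compactin_Un)
  qed
  then show ?thesis using fin sM unfolding compact_regular_def by simp
qed

text \<open>The image under \<open>T\<close> of \<open>r\<close> times the restriction of
  \<open>\<mu>\<close> to \<open>B\<close>.\<close>

definition push :: "'a topology \<Rightarrow> 'a measure \<Rightarrow> real \<Rightarrow> 'a set \<Rightarrow> ('a \<Rightarrow> 'a) \<Rightarrow> 'a measure" where
  "push X \<mu> r B T = distr (density \<mu> (\<lambda>p. ennreal (r * indicator B p))) (borel_of X) T"

lemma sets_push [simp, measurable_cong]: "sets (push X \<mu> r B T) = sets (borel_of X)"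
  by (simp add: push_def)

lemma space_push [simp]: "space (push X \<mu> r B T) = topspace X"
  by (simp add: push_def)

lemma emeasure_push:
  assumes [measurable]: "B \<in> sets \<mu>" "T \<in> \<mu> \<rightarrow>\<^sub>M borel_of X" "A \<in> sets (borel_of X)" and "r \<ge> 0"
  shows "emeasure (push X \<mu> r B T) A = ennreal r * emeasure \<mu> (T -` A \<inter> space \<mu> \<inter> B)"
proof -
  have s: "T -` A \<inter> space \<mu> \<in> sets \<mu>" by measurable
  have "emeasure (push X \<mu> r B T) A = (\<integral>\<^sup>+ p. ennreal (r * indicator B p) * indicator (T -` A \<inter> space \<mu>) p \<partial>\<mu>)"
    unfolding push_def using s by (simp add: emeasure_distr emeasure_density)
  also have "\<dots> = (\<integral>\<^sup>+ p. ennreal r * indicator (T -` A \<inter> space \<mu> \<inter> B) p \<partial>\<mu>)"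
    by (intro nn_integral_cong) (auto simp: indicator_def)
  also have "\<dots> = ennreal r * emeasure \<mu> (T -` A \<inter> space \<mu> \<inter> B)"
    using s by (intro nn_integral_cmult_indicator) auto
  finally show ?thesis .
qed

lemma integrable_push:
  fixes f :: "'a \<Rightarrow> real"
  assumes [measurable]: "B \<in> sets \<mu>" "T \<in> \<mu> \<rightarrow>\<^sub>M borel_of X" "f \<in> borel_measurable (borel_of X)" and "r \<ge> 0"
  shows "integrable (push X \<mu> r B T) f \<longleftrightarrow> integrable \<mu> (\<lambda>p. r * indicator B p * f (T p))"
  unfolding push_def using assms(4)
  by (simp add: integrable_distr_eq integrable_real_density)

lemma integral_push:
  fixes f :: "'a \<Rightarrow> real"
  assumes [measurable]: "B \<in> sets \<mu>" "T \<in> \<mu> \<rightarrow>\<^sub>M borel_of X" "f \<in> borel_measurable (borel_of X)" and "r \<ge> 0"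
  shows "(\<integral>p. f p \<partial>push X \<mu> r B T) = (\<integral>p. r * indicator B p * f (T p) \<partial>\<mu>)"
  unfolding push_def using assms(4)
  by (simp add: integral_distr integral_real_density)

text \<open>A compact subset of the part of the preimage in \<open>B\<close> has a compact image,
  since \<open>T\<close> is continuous on \<open>B\<close>; that image is the required inner
  approximation.\<close>

lemma compact_regular_push:
  assumes X: "Hausdorff_space X" and \<mu>: "compact_regular X \<mu>"
    and B: "B \<in> sets \<mu>" and T: "T \<in> \<mu> \<rightarrow>\<^sub>M borel_of X" and cont: "continuous_map (subtopology X B) X T" and r: "r \<ge> 0"
  shows "compact_regular X (push X \<mu> r B T)"
proof -
  interpret finite_measure \<mu> using \<mu> by (simp add: compact_regular_def)
  have s\<mu>: "sets \<mu> = sets (borel_of X)" using \<mu> by (simp add: compact_regular_def)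
  have sp: "space \<mu> = topspace X" using sets_eq_imp_space_eq[OF s\<mu>] by simp
  have em: "emeasure (push X \<mu> r B T) A = ennreal (r * measure \<mu> (T -` A \<inter> space \<mu> \<inter> B))"
    if "A \<in> sets (borel_of X)" for A
    using emeasure_push[OF B T that r] r by (simp add: emeasure_eq_measure ennreal_mult)
  have m: "measure (push X \<mu> r B T) A = r * measure \<mu> (T -` A \<inter> space \<mu> \<inter> B)"
    if "A \<in> sets (borel_of X)" for A
    using em[OF that] r by (simp add: measure_def)
  have fin: "finite_measure (push X \<mu> r B T)"
  proof (rule finite_measureI)
    have "topspace X \<in> sets (borel_of X)" by (rule borel_of_openin) simp
    then show "emeasure (push X \<mu> r B T) (space (push X \<mu> r B T)) \<noteq> \<infinity>" by (simp add: em)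
  qed
  have "\<exists>K. compactin X K \<and> K \<subseteq> A \<and> measure (push X \<mu> r B T) A \<le> measure (push X \<mu> r B T) K + e"
    if A: "A \<in> sets (borel_of X)" and e: "e > 0" for A e
  proof -
    let ?A = "T -` A \<inter> space \<mu> \<inter> B"
    have sA: "?A \<in> sets \<mu>" using measurable_sets[OF T A] B by blast
    \<comment> \<open>The denominator \<open>r + 1\<close> also covers \<open>r = 0\<close>.\<close>
    have e': "e / (r + 1) > 0" using e r by simp
    obtain K where K: "compactin X K" "K \<subseteq> ?A" "measure \<mu> ?A \<le> measure \<mu> K + e / (r + 1)"
      using \<mu> sA e' unfolding compact_regular_def by blast
    have TK: "compactin X (T ` K)"
      by (rule image_compactin[OF _ cont]) (use K in \<open>auto simp: compactin_subtopology\<close>)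
    have sTK: "T ` K \<in> sets (borel_of X)" by (rule borel_of_compactin[OF X TK])
    have "K \<subseteq> T -` (T ` K) \<inter> space \<mu> \<inter> B" using K(2) by auto
    then have "measure \<mu> K \<le> measure \<mu> (T -` (T ` K) \<inter> space \<mu> \<inter> B)"
      using measurable_sets[OF T sTK] B by (intro finite_measure_mono) auto
    then have "measure \<mu> ?A \<le> measure \<mu> (T -` (T ` K) \<inter> space \<mu> \<inter> B) + e / (r + 1)" using K(3) by simp
    then have "r * measure \<mu> ?A \<le> r * measure \<mu> (T -` (T ` K) \<inter> space \<mu> \<inter> B) + r * (e / (r + 1))"
      using r by (metis distrib_left mult_left_mono)
    moreover have "r * (e / (r + 1)) \<le> e" using r e by (simp add: field_simps)
    ultimately have "measure (push X \<mu> r B T) A \<le> measure (push X \<mu> r B T) (T ` K) + e"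
      using m[OF A] m[OF sTK] by simp
    then show ?thesis using TK K(2) by blast
  qed
  then show ?thesis using fin unfolding compact_regular_def by simp
qed

section \<open>Supports of Radon measures\<close>

lemma msupport_null_neighbourhood:
  assumes "p \<in> topspace X" "p \<notin> msupport X \<mu>"
  obtains U where "openin X U" "p \<in> U" "emeasure \<mu> U = 0"
  using assms unfolding msupport_def by (auto simp: not_less)

lemma closedin_msupport: "closedin X (msupport X \<mu>)"
proof -
  have "openin X (topspace X - msupport X \<mu>)"
  proof (subst openin_subopen, intro ballI)
    fix p assume "p \<in> topspace X - msupport X \<mu>"
    then obtain U where U: "openin X U" "p \<in> U" "emeasure \<mu> U = 0"
      using msupport_null_neighbourhood by (metis DiffE)
    then have "U \<subseteq> topspace X - msupport X \<mu>"
      using openin_subset[OF U(1)] unfolding msupport_def by auto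
    with U show "\<exists>T. openin X T \<and> p \<in> T \<and> T \<subseteq> topspace X - msupport X \<mu>" by blast
  qed
  then show ?thesis unfolding closedin_def by (auto simp: msupport_def)
qed

text \<open>No countable base is at hand for \<open>X\<close>, so inner regularity does the work: a
  compact set off the support is covered by finitely many open null sets.\<close>

lemma radon_msupport_compl_null:
  assumes X: "Hausdorff_space X" and \<mu>: "radon_measure X \<mu>"
  shows "topspace X - msupport X \<mu> \<in> null_sets \<mu>"
proof -
  let ?U = "topspace X - msupport X \<mu>"
  have U: "openin X ?U" using closedin_msupport by blast
  have s\<mu>: "sets \<mu> = sets (borel_of X)" using \<mu> by (simp add: radon_measure_def)
  have sU: "?U \<in> sets \<mu>" using borel_of_openin[OF U] by (simp add: s\<mu>)
  have "emeasure \<mu> K = 0" if K: "compactin X K" "K \<subseteq> ?U" for K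
  proof -
    let ?W = "{W. openin X W \<and> emeasure \<mu> W = 0}"
    have "\<exists>\<F>. finite \<F> \<and> \<F> \<subseteq> ?W \<and> K \<subseteq> \<Union>\<F>"
    proof (rule compactinD[OF K(1)])
      show "openin X W" if "W \<in> ?W" for W using that by simp
      show "K \<subseteq> \<Union>?W"
      proof
        fix p assume "p \<in> K"
        then have "p \<in> topspace X" "p \<notin> msupport X \<mu>" using K(2) by auto
        then show "p \<in> \<Union>?W" using msupport_null_neighbourhood by (metis (mono_tags, lifting) UnionI mem_Collect_eq)
      qed
    qed
    then obtain \<F> where F: "finite \<F>" "\<F> \<subseteq> ?W" "K \<subseteq> \<Union>\<F>" by blast
    have "(\<Union>W\<in>\<F>. W) \<in> null_sets \<mu>"
    proof (rule null_sets_UN')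
      show "countable \<F>" using F(1) by (rule countable_finite)
      show "W \<in> null_sets \<mu>" if "W \<in> \<F>" for W
        using F(2) that borel_of_openin by (auto simp: null_sets_def s\<mu>)
    qed
    then have "emeasure \<mu> (\<Union>\<F>) = 0" "\<Union>\<F> \<in> sets \<mu>" by (auto simp: null_sets_def)
    then show ?thesis using emeasure_mono[OF F(3), of \<mu>] by simp
  qed
  then have "(SUP K\<in>{K. compactin X K \<and> K \<in> sets \<mu> \<and> K \<subseteq> ?U}. emeasure \<mu> K) \<le> 0"
    by (intro SUP_least) simp
  then have "emeasure \<mu> ?U = 0" using \<mu> sU unfolding radon_measure_def by simp
  then show ?thesis using sU by (simp add: null_sets_def)
qed

text \<open>All the mass sits on the support, a compact set, where a Radon measure is
  finite.\<close>

lemma compact_radon_finite: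
  assumes X: "Hausdorff_space X" and \<mu>: "\<mu> \<in> compact_radon X"
  shows "finite_measure \<mu>"
proof (rule finite_measureI)
  have r: "radon_measure X \<mu>" and K: "compactin X (msupport X \<mu>)" using \<mu> by (auto simp: compact_radon_def)
  have sp: "space \<mu> = topspace X" and s: "sets \<mu> = sets (borel_of X)" using r by (auto simp: radon_measure_def)
  have sK: "msupport X \<mu> \<in> sets \<mu>" using borel_of_compactin[OF X K] by (simp add: s)
  have "emeasure \<mu> (msupport X \<mu> \<union> (topspace X - msupport X \<mu>)) = emeasure \<mu> (msupport X \<mu>)"
    by (rule emeasure_Un_null_set[OF sK radon_msupport_compl_null[OF X r]])
  moreover have "msupport X \<mu> \<union> (topspace X - msupport X \<mu>) = space \<mu>" using sp by (auto simp: msupport_def)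
  moreover have "emeasure \<mu> (msupport X \<mu>) < \<infinity>" using r K sK unfolding radon_measure_def by blast
  ultimately show "emeasure \<mu> (space \<mu>) \<noteq> \<infinity>" by simp
qed

lemma compact_radon_imp_regular:
  assumes X: "Hausdorff_space X" and \<mu>: "\<mu> \<in> compact_radon X"
  shows "compact_regular X \<mu>"
proof -
  interpret finite_measure \<mu> by (rule compact_radon_finite[OF assms])
  have r: "radon_measure X \<mu>" using \<mu> by (auto simp: compact_radon_def)
  then have s: "sets \<mu> = sets (borel_of X)" by (auto simp: radon_measure_def)
  have "\<exists>K. compactin X K \<and> K \<subseteq> A \<and> measure \<mu> A \<le> measure \<mu> K + e" if A: "A \<in> sets \<mu>" "e > 0" for A e
  proof (cases "measure \<mu> A \<le> e")
    case True
    then show ?thesis by (intro exI[of _ "{}"]) simp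
  next
    case False
    have "ennreal (measure \<mu> A - e) < emeasure \<mu> A"
      using False A(2) by (simp add: emeasure_eq_measure ennreal_less_iff)
    also have "emeasure \<mu> A = (SUP K\<in>{K. compactin X K \<and> K \<in> sets \<mu> \<and> K \<subseteq> A}. emeasure \<mu> K)"
      using r A unfolding radon_measure_def by blast
    finally obtain K where "compactin X K" "K \<subseteq> A" "ennreal (measure \<mu> A - e) < emeasure \<mu> K"
      by (auto simp: less_SUP_iff)
    moreover then have "measure \<mu> A - e < measure \<mu> K"
      using False by (simp add: emeasure_eq_measure ennreal_less_iff)
    ultimately show ?thesis by (intro exI[of _ K]) simp
  qed
  then show ?thesis using s finite_measure_axioms unfolding compact_regular_def by blast
qed

text \<open>A continuous function is bounded on the compact support, whose complement is null, and
  the measure is finite.\<close>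

lemma integrable_compact_radon:
  assumes X: "Hausdorff_space X" and \<mu>: "\<mu> \<in> compact_radon X" and f: "continuous_map X euclideanreal f"
  shows "integrable \<mu> f"
proof -
  interpret finite_measure \<mu> by (rule compact_radon_finite[OF X \<mu>])
  have r: "radon_measure X \<mu>" and K: "compactin X (msupport X \<mu>)" using \<mu> by (auto simp: compact_radon_def)
  have sp: "space \<mu> = topspace X" and s: "sets \<mu> = sets (borel_of X)" using r by (auto simp: radon_measure_def)
  have "compactin euclideanreal (f ` msupport X \<mu>)" by (rule image_compactin[OF K f])
  then have "bounded (f ` msupport X \<mu>)" by (simp add: compact_imp_bounded)
  then obtain C where C: "\<And>p. p \<in> msupport X \<mu> \<Longrightarrow> norm (f p) \<le> C" unfolding bounded_iff by blast
  have "f \<in> borel_of X \<rightarrow>\<^sub>M borel_of euclidean" by (rule measurable_borel_of[OF f])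
  then have fm: "f \<in> borel_measurable \<mu>"
    using measurable_cong_sets[OF s sets_borel_of_euclidean[symmetric]] by blast
  have "AE p in \<mu>. p \<notin> topspace X - msupport X \<mu>"
    by (rule AE_not_in[OF radon_msupport_compl_null[OF X r]])
  then have "AE p in \<mu>. norm (f p) \<le> C"
    by (rule AE_mp) (use C in \<open>auto simp: sp intro!: AE_I2\<close>)
  then show ?thesis by (intro integrable_const_bound[of _ C] fm)
qed

section \<open>The perturbed measure\<close>

lemma measurable_extend_by_id:
  assumes "K \<in> sets (borel_of X)" "continuous_map (subtopology X K) X T"
  shows "(\<lambda>p. if p \<in> K then T p else p) \<in> borel_of X \<rightarrow>\<^sub>M borel_of X"
proof (subst measurable_If_restrict_space_iff)
  have "K \<subseteq> topspace X" using sets.sets_into_space[OF assms(1)] by simp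
  then have "{x \<in> space (borel_of X). x \<in> K} = K" by auto
  then show "{x \<in> space (borel_of X). x \<in> K} \<in> sets (borel_of X)" using assms(1) by simp
  show "T \<in> restrict_space (borel_of X) {x. x \<in> K} \<rightarrow>\<^sub>M borel_of X \<and>
    (\<lambda>p. p) \<in> restrict_space (borel_of X) {x. x \<notin> K} \<rightarrow>\<^sub>M borel_of X"
    using measurable_restrict_borel_of[OF assms(2)] by (auto intro: measurable_restrict_space1)
qed

text \<open>Off \<open>K\<close> the measure is kept; on \<open>K\<close> it is replaced by
  \<open>a\<close> times its image under \<open>T1\<close> plus \<open>b\<close> times its image
  under \<open>T2\<close>. The common factor \<open>k\<close> is for restoring total mass 1. The
  maps are extended by the identity because \<open>push\<close> needs maps measurable on the whole
  space; the extended values carry no mass.\<close>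

definition perturb :: "'a topology \<Rightarrow> 'a measure \<Rightarrow> real \<Rightarrow> real \<Rightarrow> real \<Rightarrow> 'a set \<Rightarrow> ('a \<Rightarrow> 'a) \<Rightarrow> ('a \<Rightarrow> 'a) \<Rightarrow> 'a measure" where
  "perturb X \<mu> k a b K T1 T2 = plus_measure (push X \<mu> k (topspace X - K) (\<lambda>p. p))
     (plus_measure (push X \<mu> (k * a) K (\<lambda>p. if p \<in> K then T1 p else p)) (push X \<mu> (k * b) K (\<lambda>p. if p \<in> K then T2 p else p)))"

lemma sets_compact_radon: "\<mu> \<in> compact_radon X \<Longrightarrow> sets \<mu> = sets (borel_of X)"
  by (simp add: compact_radon_def radon_measure_def)

lemma space_compact_radon: "\<mu> \<in> compact_radon X \<Longrightarrow> space \<mu> = topspace X"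
  by (simp add: compact_radon_def radon_measure_def)

context
  fixes X :: "'a topology" and \<mu> :: "'a measure" and k a b :: real and K :: "'a set" and T1 T2 :: "'a \<Rightarrow> 'a"
  assumes X: "Hausdorff_space X" and \<mu>: "\<mu> \<in> compact_radon X" and K: "compactin X K"
    and T1: "continuous_map (subtopology X K) X T1" and T2: "continuous_map (subtopology X K) X T2"
    and k: "k \<ge> 0" and a: "a \<ge> 0" and b: "b \<ge> 0"
begin

lemma perturb_sets: "K \<in> sets \<mu>" "topspace X - K \<in> sets \<mu>"
proof -
  show "K \<in> sets \<mu>" using borel_of_compactin[OF X K] by (simp add: sets_compact_radon[OF \<mu>])
  then have "space \<mu> - K \<in> sets \<mu>" by blast
  then show "topspace X - K \<in> sets \<mu>" by (simp add: space_compact_radon[OF \<mu>])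
qed

lemma perturb_maps:
  "(\<lambda>p. p) \<in> \<mu> \<rightarrow>\<^sub>M borel_of X"
  "(\<lambda>p. if p \<in> K then T1 p else p) \<in> \<mu> \<rightarrow>\<^sub>M borel_of X"
  "(\<lambda>p. if p \<in> K then T2 p else p) \<in> \<mu> \<rightarrow>\<^sub>M borel_of X"
proof -
  have s: "\<mu> \<rightarrow>\<^sub>M borel_of X = borel_of X \<rightarrow>\<^sub>M borel_of X"
    by (rule measurable_cong_sets[OF sets_compact_radon[OF \<mu>] refl])
  have KX: "K \<in> sets (borel_of X)" using perturb_sets by (simp add: sets_compact_radon[OF \<mu>])
  show "(\<lambda>p. p) \<in> \<mu> \<rightarrow>\<^sub>M borel_of X" unfolding s by simp
  show "(\<lambda>p. if p \<in> K then T1 p else p) \<in> \<mu> \<rightarrow>\<^sub>M borel_of X"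
    unfolding s by (rule measurable_extend_by_id[OF KX T1])
  show "(\<lambda>p. if p \<in> K then T2 p else p) \<in> \<mu> \<rightarrow>\<^sub>M borel_of X"
    unfolding s by (rule measurable_extend_by_id[OF KX T2])
qed

lemma compact_regular_perturb: "compact_regular X (perturb X \<mu> k a b K T1 T2)"
proof -
  have r: "compact_regular X \<mu>" by (rule compact_radon_imp_regular[OF X \<mu>])
  have c: "continuous_map (subtopology X K) X (\<lambda>p. if p \<in> K then T p else p)"
    if "continuous_map (subtopology X K) X T" for T
    by (rule continuous_map_eq[OF that]) simp
  show ?thesis unfolding perturb_def
    by (intro compact_regular_plus X compact_regular_push r perturb_sets perturb_maps c T1 T2 mult_nonneg_nonneg k a b)
      (simp add: continuous_map_from_subtopology)
qed

text \<open>The new support lies in the union of the old one and the compact images of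
  \<open>K\<close> under \<open>T1\<close> and \<open>T2\<close>.\<close>

lemma perturb_compact_radon: "perturb X \<mu> k a b K T1 T2 \<in> compact_radon X"
proof -
  let ?\<nu> = "perturb X \<mu> k a b K T1 T2"
  let ?T = "\<lambda>T p. if p \<in> K then T p else p"
  have r: "radon_measure X ?\<nu>" by (rule compact_regular_imp_radon[OF X compact_regular_perturb])
  have cT: "compactin X (T ` K)" if "continuous_map (subtopology X K) X T" for T
    using K image_compactin[OF _ that, of K] by (simp add: compactin_subtopology)
  let ?S = "msupport X \<mu> \<union> T1 ` K \<union> T2 ` K"
  have S: "compactin X ?S"
    using \<mu> cT[OF T1] cT[OF T2] by (intro compactin_Un) (auto simp: compact_radon_def)
  have "msupport X ?\<nu> \<subseteq> ?S"
  proof (rule ccontr)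
    assume "\<not> msupport X ?\<nu> \<subseteq> ?S"
    then obtain p where p: "p \<in> msupport X ?\<nu>" "p \<notin> ?S" by blast
    then have pX: "p \<in> topspace X" by (simp add: msupport_def)
    then obtain U where U: "openin X U" "p \<in> U" "emeasure \<mu> U = 0"
      using msupport_null_neighbourhood p(2) by (metis UnCI)
    \<comment> \<open>Compact images are closed, so this is still an open neighbourhood of
      \<open>p\<close>, and each of the three summands of the perturbation vanishes on it.\<close>
    let ?U = "U - (T1 ` K \<union> T2 ` K)"
    have oU: "openin X ?U"
      by (intro openin_diff U closedin_Un compactin_imp_closedin[OF X] cT T1 T2)
    have sU: "?U \<in> sets (borel_of X)" by (rule borel_of_openin[OF oU])
    have "emeasure \<mu> ((\<lambda>p. p) -` ?U \<inter> space \<mu> \<inter> (topspace X - K)) \<le> emeasure \<mu> U"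
      using borel_of_openin[OF U(1)] by (intro emeasure_mono) (auto simp: sets_compact_radon[OF \<mu>])
    then have 0: "emeasure \<mu> ((\<lambda>p. p) -` ?U \<inter> space \<mu> \<inter> (topspace X - K)) = 0" using U(3) by simp
    have e: "(?T T1 -` ?U) \<inter> space \<mu> \<inter> K = {}" "(?T T2 -` ?U) \<inter> space \<mu> \<inter> K = {}" by auto
    have "emeasure ?\<nu> ?U = 0"
      using sU k a b perturb_sets perturb_maps 0
      by (simp add: perturb_def emeasure_plus_measure emeasure_push e)
    moreover have "emeasure ?\<nu> ?U > 0" using p oU U(2) unfolding msupport_def by blast
    ultimately show False by simp
  qed
  then have "compactin X (msupport X ?\<nu>)" by (rule closed_compactin[OF S _ closedin_msupport])
  with r show ?thesis by (simp add: compact_radon_def)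
qed

lemma perturb_integral:
  fixes f :: "'a \<Rightarrow> real"
  assumes f: "f \<in> borel_measurable (borel_of X)" and i: "integrable (perturb X \<mu> k a b K T1 T2) f"
  defines "g \<equiv> \<lambda>p. k * (if p \<in> K then a * f (T1 p) + b * f (T2 p) else f p)"
  shows "integrable \<mu> g" "(\<integral>p. f p \<partial>perturb X \<mu> k a b K T1 T2) = (\<integral>p. g p \<partial>\<mu>)"
proof -
  let ?T = "\<lambda>T p. if p \<in> K then T p else p"
  let ?N0 = "push X \<mu> k (topspace X - K) (\<lambda>p. p)"
  let ?N1 = "push X \<mu> (k * a) K (?T T1)"
  let ?N2 = "push X \<mu> (k * b) K (?T T2)"
  let ?f0 = "\<lambda>p. k * indicator (topspace X - K) p * f p"
  let ?f1 = "\<lambda>p. (k * a) * indicator K p * f (?T T1 p)"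
  let ?f2 = "\<lambda>p. (k * b) * indicator K p * f (?T T2 p)"
  have ka: "k * a \<ge> 0" "k * b \<ge> 0" using k a b by auto
  have N: "integrable ?N0 f" "integrable ?N1 f" "integrable ?N2 f"
    using i by (simp_all add: perturb_def integrable_plus_measure)
  have i0: "integrable \<mu> ?f0" using N(1) integrable_push[OF perturb_sets(2) perturb_maps(1) f k] by simp
  have i1: "integrable \<mu> ?f1" using N(2) integrable_push[OF perturb_sets(1) perturb_maps(2) f ka(1)] by simp
  have i2: "integrable \<mu> ?f2" using N(3) integrable_push[OF perturb_sets(1) perturb_maps(3) f ka(2)] by simp
  have g: "g p = ?f0 p + (?f1 p + ?f2 p)" if "p \<in> space \<mu>" for p
    using that by (auto simp: g_def space_compact_radon[OF \<mu>] indicator_def algebra_simps)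
  have "integrable \<mu> (\<lambda>p. ?f0 p + (?f1 p + ?f2 p))" by (intro Bochner_Integration.integrable_add i0 i1 i2)
  moreover have "integrable \<mu> g \<longleftrightarrow> integrable \<mu> (\<lambda>p. ?f0 p + (?f1 p + ?f2 p))"
    by (rule Bochner_Integration.integrable_cong[OF refl g])
  ultimately show "integrable \<mu> g" by simp
  have "(\<integral>p. f p \<partial>perturb X \<mu> k a b K T1 T2) = (\<integral>p. f p \<partial>?N0) + ((\<integral>p. f p \<partial>?N1) + (\<integral>p. f p \<partial>?N2))"
    unfolding perturb_def using N by (simp add: integral_plus_measure integrable_plus_measure)
  also have "\<dots> = (\<integral>p. ?f0 p \<partial>\<mu>) + ((\<integral>p. ?f1 p \<partial>\<mu>) + (\<integral>p. ?f2 p \<partial>\<mu>))"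
    using integral_push[OF perturb_sets(2) perturb_maps(1) f k]
      integral_push[OF perturb_sets(1) perturb_maps(2) f ka(1)]
      integral_push[OF perturb_sets(1) perturb_maps(3) f ka(2)] by simp
  also have "\<dots> = (\<integral>p. ?f0 p + (?f1 p + ?f2 p) \<partial>\<mu>)"
    using i0 i1 i2 by (simp add: Bochner_Integration.integral_add)
  also have "\<dots> = (\<integral>p. g p \<partial>\<mu>)"
    by (rule Bochner_Integration.integral_cong[OF refl g, symmetric])
  finally show "(\<integral>p. f p \<partial>perturb X \<mu> k a b K T1 T2) = (\<integral>p. g p \<partial>\<mu>)" .
qed

lemma perturb_mass:
  "emeasure (perturb X \<mu> k a b K T1 T2) (topspace X) =
     ennreal (k * (measure \<mu> (topspace X - K) + (a + b) * measure \<mu> K))"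
proof -
  interpret finite_measure \<mu> by (rule compact_radon_finite[OF X \<mu>])
  let ?T = "\<lambda>T p. if p \<in> K then T p else p"
  have KX: "K \<subseteq> topspace X" using K by (rule compactin_subset_topspace)
  have t: "topspace X \<in> sets (borel_of X)" by (rule borel_of_openin) simp
  have "(\<lambda>p. p) -` topspace X \<inter> space \<mu> \<inter> (topspace X - K) = topspace X - K"
    "(?T T1) -` topspace X \<inter> space \<mu> \<inter> K = K" "(?T T2) -` topspace X \<inter> space \<mu> \<inter> K = K"
    using KX T1 T2 by (auto simp: space_compact_radon[OF \<mu>] continuous_map_def Pi_def)
  then have "emeasure (perturb X \<mu> k a b K T1 T2) (topspace X) =
     ennreal k * emeasure \<mu> (topspace X - K) + (ennreal (k * a) * emeasure \<mu> K + ennreal (k * b) * emeasure \<mu> K)"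
    using t k a b perturb_sets perturb_maps by (simp add: perturb_def emeasure_plus_measure emeasure_push)
  also have "\<dots> = ennreal (k * measure \<mu> (topspace X - K) + (k * a * measure \<mu> K + k * b * measure \<mu> K))"
    using k a b by (simp add: emeasure_eq_measure ennreal_mult ennreal_plus)
  finally show ?thesis by (simp add: algebra_simps)
qed

text \<open>Written over \<open>\<mu>\<close>, the integrand equals \<open>k * f\<close> off
  \<open>K\<close> and is strictly smaller on \<open>K\<close>, which has positive measure.\<close>

lemma perturb_integral_less:
  fixes f :: "'a \<Rightarrow> real"
  assumes f: "f \<in> borel_measurable (borel_of X)" "integrable (perturb X \<mu> k a b K T1 T2) f" "integrable \<mu> f"
    and k0: "k > 0" and pos: "measure \<mu> K > 0" and less: "\<And>p. p \<in> K \<Longrightarrow> a * f (T1 p) + b * f (T2 p) < f p"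
  shows "(\<integral>p. f p \<partial>perturb X \<mu> k a b K T1 T2) < k * (\<integral>p. f p \<partial>\<mu>)"
proof -
  interpret finite_measure \<mu> by (rule compact_radon_finite[OF X \<mu>])
  let ?g = "\<lambda>p. k * (if p \<in> K then a * f (T1 p) + b * f (T2 p) else f p)"
  have "(\<integral>p. ?g p \<partial>\<mu>) < (\<integral>p. k * f p \<partial>\<mu>)"
  proof (rule integral_less_AE)
    show "integrable \<mu> ?g" by (rule perturb_integral[OF f(1,2)])
    show "integrable \<mu> (\<lambda>p. k * f p)" using f(3) by simp
    show "emeasure \<mu> K \<noteq> 0" using pos by (auto simp: measure_def)
    show "K \<in> sets \<mu>" by (rule perturb_sets)
    show "AE p in \<mu>. p \<in> K \<longrightarrow> ?g p \<noteq> k * f p" using less k0 by (auto intro!: AE_I2 simp: less_imp_neq)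
    show "AE p in \<mu>. ?g p \<le> k * f p" using less k0 by (auto intro!: AE_I2 less_imp_le)
  qed
  then show ?thesis using perturb_integral(2)[OF f(1,2)] by simp
qed

end

section \<open>The tangent bundle\<close>

text \<open>\<open>Ck_on\<close> controls derivatives in basis directions only; this expansion makes
  joint continuity in the point and the direction available.\<close>

lemma frechet_derivative_linear_expansion:
  fixes f :: "'e::euclidean_space \<Rightarrow> 'b::real_normed_vector"
  assumes "f differentiable (at y)"
  shows "frechet_derivative f (at y) \<xi> = (\<Sum>b\<in>Basis. (\<xi> \<bullet> b) *\<^sub>R frechet_derivative f (at y) b)"
proof -
  have lin: "linear (frechet_derivative f (at y))" by (rule linear_frechet_derivative[OF assms])
  have "frechet_derivative f (at y) \<xi> = frechet_derivative f (at y) (\<Sum>b\<in>Basis. (\<xi> \<bullet> b) *\<^sub>R b)"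
    by (simp add: euclidean_representation)
  also have "\<dots> = (\<Sum>b\<in>Basis. (\<xi> \<bullet> b) *\<^sub>R frechet_derivative f (at y) b)"
    by (simp add: linear_sum[OF lin] linear_cmul[OF lin])
  finally show ?thesis .
qed

lemma continuous_on_frechet_derivative:
  fixes f :: "'e::euclidean_space \<Rightarrow> 'b::real_normed_vector"
  assumes "Ck_on (Suc 0) f V"
  shows "continuous_on (V \<times> UNIV) (\<lambda>z. frechet_derivative f (at (fst z)) (snd z))"
proof -
  have "continuous_on (V \<times> UNIV) (\<lambda>z. \<Sum>b\<in>Basis. (snd z \<bullet> b) *\<^sub>R frechet_derivative f (at (fst z)) b)"
  proof (intro continuous_on_sum continuous_on_scaleR continuous_on_inner continuous_on_snd continuous_on_const continuous_on_id)
    fix b :: 'e assume "b \<in> Basis"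
    then have "continuous_on V (\<lambda>y. frechet_derivative f (at y) b)" using assms by simp
    then show "continuous_on (V \<times> UNIV) (\<lambda>z. frechet_derivative f (at (fst z)) b)"
      by (rule continuous_on_compose2) (auto intro: continuous_on_fst continuous_on_id)
  qed
  moreover have "(\<Sum>b\<in>Basis. (snd z \<bullet> b) *\<^sub>R frechet_derivative f (at (fst z)) b) = frechet_derivative f (at (fst z)) (snd z)"
    if "z \<in> V \<times> UNIV" for z
  proof -
    have "f differentiable (at (fst z))" using assms that by auto
    then show ?thesis by (rule frechet_derivative_linear_expansion[symmetric])
  qed
  ultimately show ?thesis by (rule continuous_on_eq)
qed

lemma Ck_on_1_continuous_on:
  assumes "Ck_on (Suc 0) f V"
  shows "continuous_on V f"
  using assms by (intro differentiable_imp_continuous_on differentiable_at_imp_differentiable_on) simp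

section \<open>Charts, coordinate changes and tangent vectors\<close>

context
  fixes M :: "('a, 'e::euclidean_space) manifold"
  assumes M: "smooth_manifold M"
begin

lemma chart_dom_openin: "\<kappa> \<in> atlas M \<Longrightarrow> openin (mtop M) (chart_dom \<kappa>)"
  using M by (simp add: smooth_manifold_def)

lemma chart_image_open: "\<kappa> \<in> atlas M \<Longrightarrow> open (chart_map \<kappa> ` chart_dom \<kappa>)"
  using M by (simp add: smooth_manifold_def)

lemma chart_homeomorphic:
  "\<kappa> \<in> atlas M \<Longrightarrow> homeomorphic_map (subtopology (mtop M) (chart_dom \<kappa>))
     (top_of_set (chart_map \<kappa> ` chart_dom \<kappa>)) (chart_map \<kappa>)"
  using M by (simp add: smooth_manifold_def)

lemma chart_dom_topspace: "\<kappa> \<in> atlas M \<Longrightarrow> topspace (subtopology (mtop M) (chart_dom \<kappa>)) = chart_dom \<kappa>"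
  using openin_subset[OF chart_dom_openin, of \<kappa>] by (simp add: Int_absorb1)

lemma chart_inj: "\<kappa> \<in> atlas M \<Longrightarrow> inj_on (chart_map \<kappa>) (chart_dom \<kappa>)"
  using homeomorphic_imp_injective_map[OF chart_homeomorphic] chart_dom_topspace by metis

lemma chart_inv_chart [simp]: "\<kappa> \<in> atlas M \<Longrightarrow> x \<in> chart_dom \<kappa> \<Longrightarrow> chart_inv \<kappa> (chart_map \<kappa> x) = x"
  unfolding chart_inv_def by (simp add: chart_inj)

lemma chart_chart_inv [simp]: "y \<in> chart_map \<kappa> ` chart_dom \<kappa> \<Longrightarrow> chart_map \<kappa> (chart_inv \<kappa> y) = y"
  unfolding chart_inv_def by (rule f_inv_into_f)

lemma chart_inv_dom: "y \<in> chart_map \<kappa> ` chart_dom \<kappa> \<Longrightarrow> chart_inv \<kappa> y \<in> chart_dom \<kappa>"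
  unfolding chart_inv_def by (rule inv_into_into)

lemma chart_image_Int_open:
  assumes "\<kappa> \<in> atlas M" "openin (mtop M) U"
  shows "open (chart_map \<kappa> ` (chart_dom \<kappa> \<inter> U))"
proof -
  have "openin (subtopology (mtop M) (chart_dom \<kappa>)) (chart_dom \<kappa> \<inter> U)"
    using assms(2) by (auto simp: openin_subtopology)
  then have "openin (top_of_set (chart_map \<kappa> ` chart_dom \<kappa>)) (chart_map \<kappa> ` (chart_dom \<kappa> \<inter> U))"
    using homeomorphic_imp_open_map[OF chart_homeomorphic[OF assms(1)]] by (simp add: open_map_def)
  then show ?thesis using openin_open_trans chart_image_open[OF assms(1)] by blast
qed

lemma transition_C1:
  "\<kappa> \<in> atlas M \<Longrightarrow> \<kappa>' \<in> atlas M \<Longrightarrow>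
    Ck_on (Suc 0) (chart_map \<kappa>' \<circ> chart_inv \<kappa>) (chart_map \<kappa> ` (chart_dom \<kappa> \<inter> chart_dom \<kappa>'))"
  using M unfolding smooth_manifold_def smooth_on_def by blast

lemma transition_has_derivative:
  assumes "\<kappa> \<in> charts_at M x" "\<kappa>' \<in> charts_at M x"
  shows "(chart_map \<kappa>' \<circ> chart_inv \<kappa> has_derivative
    frechet_derivative (chart_map \<kappa>' \<circ> chart_inv \<kappa>) (at (chart_map \<kappa> x))) (at (chart_map \<kappa> x))"
proof -
  have "chart_map \<kappa>' \<circ> chart_inv \<kappa> differentiable (at (chart_map \<kappa> x))"
    using transition_C1[of \<kappa> \<kappa>'] assms by (auto simp: charts_at_def)
  then show ?thesis using frechet_derivative_works by blast
qed

text \<open>Serves twice: for real \<open>f\<close> it makes the differential independent of the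
  chart, and for \<open>f\<close> a third chart map it is the cocycle identity of coordinate
  changes. The composed representation agrees only on the overlap of the charts, hence the passage
  through an open set.\<close>

lemma chain_rule_charts:
  fixes f :: "'a \<Rightarrow> 'b::real_normed_vector"
  assumes k: "\<kappa> \<in> charts_at M x" "\<kappa>' \<in> charts_at M x"
    and f: "f \<circ> chart_inv \<kappa>' differentiable (at (chart_map \<kappa>' x))"
  shows "frechet_derivative (f \<circ> chart_inv \<kappa>) (at (chart_map \<kappa> x)) \<xi> =
    frechet_derivative (f \<circ> chart_inv \<kappa>') (at (chart_map \<kappa>' x))
      (frechet_derivative (chart_map \<kappa>' \<circ> chart_inv \<kappa>) (at (chart_map \<kappa> x)) \<xi>)"
proof -
  have a: "\<kappa> \<in> atlas M" "\<kappa>' \<in> atlas M" "x \<in> chart_dom \<kappa>" "x \<in> chart_dom \<kappa>'"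
    using k by (auto simp: charts_at_def)
  let ?\<tau> = "chart_map \<kappa>' \<circ> chart_inv \<kappa>" and ?y = "chart_map \<kappa> x"
  let ?D = "frechet_derivative (f \<circ> chart_inv \<kappa>') (at (chart_map \<kappa>' x)) \<circ> frechet_derivative ?\<tau> (at ?y)"
  have "?\<tau> ?y = chart_map \<kappa>' x" using a by simp
  then have "((f \<circ> chart_inv \<kappa>') has_derivative frechet_derivative (f \<circ> chart_inv \<kappa>') (at (chart_map \<kappa>' x))) (at (?\<tau> ?y))"
    using f frechet_derivative_works by metis
  then have "((f \<circ> chart_inv \<kappa>') \<circ> ?\<tau> has_derivative ?D) (at ?y)"
    by (rule diff_chain_at[OF transition_has_derivative[OF k]])
  then have "(f \<circ> chart_inv \<kappa> has_derivative ?D) (at ?y)"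
  proof (rule has_derivative_transform_within_open)
    show "open (chart_map \<kappa> ` (chart_dom \<kappa> \<inter> chart_dom \<kappa>'))"
      by (rule chart_image_Int_open[OF a(1) chart_dom_openin[OF a(2)]])
    show "?y \<in> chart_map \<kappa> ` (chart_dom \<kappa> \<inter> chart_dom \<kappa>')" using a by blast
    show "((f \<circ> chart_inv \<kappa>') \<circ> ?\<tau>) y = (f \<circ> chart_inv \<kappa>) y"
      if "y \<in> chart_map \<kappa> ` (chart_dom \<kappa> \<inter> chart_dom \<kappa>')" for y
      using that a by auto
  qed
  then have "?D = frechet_derivative (f \<circ> chart_inv \<kappa>) (at ?y)" by (rule frechet_derivative_at)
  then show ?thesis by (metis comp_apply)
qed

lemma frechet_derivative_transition_self:
  assumes "\<kappa> \<in> charts_at M x"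
  shows "frechet_derivative (chart_map \<kappa> \<circ> chart_inv \<kappa>) (at (chart_map \<kappa> x)) \<xi> = \<xi>"
proof -
  have a: "\<kappa> \<in> atlas M" "x \<in> chart_dom \<kappa>" using assms by (auto simp: charts_at_def)
  have "(chart_map \<kappa> \<circ> chart_inv \<kappa> has_derivative (\<lambda>\<xi>. \<xi>)) (at (chart_map \<kappa> x))"
    by (rule has_derivative_transform_within_open[OF has_derivative_ident chart_image_open[OF a(1)]])
      (use a in auto)
  then show ?thesis by (metis frechet_derivative_at)
qed

lemma tangent_space_coord_change:
  "v \<in> tangent_space M x \<Longrightarrow> \<kappa> \<in> charts_at M x \<Longrightarrow> \<kappa>' \<in> charts_at M x \<Longrightarrow>
    v \<kappa>' = frechet_derivative (chart_map \<kappa>' \<circ> chart_inv \<kappa>) (at (chart_map \<kappa> x)) (v \<kappa>)"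
  unfolding tangent_space_def by blast

lemma tangent_space_eqI:
  assumes "\<kappa> \<in> charts_at M x" "v \<in> tangent_space M x" "w \<in> tangent_space M x" "v \<kappa> = w \<kappa>"
  shows "v = w"
proof
  fix \<kappa>'
  show "v \<kappa>' = w \<kappa>'"
  proof (cases "\<kappa>' \<in> charts_at M x")
    case True
    show ?thesis
      using tangent_space_coord_change[OF assms(2,1) True] tangent_space_coord_change[OF assms(3,1) True] assms(4)
      by simp
  next
    case False
    then show ?thesis using assms(2,3) by (simp add: tangent_space_def del: split_paired_All)
  qed
qed

text \<open>The cocycle identity makes this family compatible, so every coordinate vector belongs to
  some tangent vector.\<close>

lemma tangent_space_lift:
  assumes k: "\<kappa> \<in> charts_at M x"
  shows "(\<lambda>\<kappa>'. if \<kappa>' \<in> charts_at M x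
      then frechet_derivative (chart_map \<kappa>' \<circ> chart_inv \<kappa>) (at (chart_map \<kappa> x)) \<xi> else 0) \<in> tangent_space M x"
  unfolding tangent_space_def
proof (intro CollectI conjI ballI allI impI)
  fix \<kappa>1 \<kappa>2 assume k12: "\<kappa>1 \<in> charts_at M x" "\<kappa>2 \<in> charts_at M x"
  then have "chart_map \<kappa>2 \<circ> chart_inv \<kappa>1 differentiable (at (chart_map \<kappa>1 x))"
    using transition_has_derivative unfolding differentiable_def by blast
  from chain_rule_charts[OF k k12(1) this]
  show "(if \<kappa>2 \<in> charts_at M x then frechet_derivative (chart_map \<kappa>2 \<circ> chart_inv \<kappa>) (at (chart_map \<kappa> x)) \<xi> else 0) =
      frechet_derivative (chart_map \<kappa>2 \<circ> chart_inv \<kappa>1) (at (chart_map \<kappa>1 x))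
        (if \<kappa>1 \<in> charts_at M x then frechet_derivative (chart_map \<kappa>1 \<circ> chart_inv \<kappa>) (at (chart_map \<kappa> x)) \<xi> else 0)"
    using k12 by simp
qed simp

lemma
  assumes k: "\<kappa> \<in> charts_at M x"
  shows tangent_vec_in: "tangent_vec M x \<kappa> \<xi> \<in> tangent_space M x"
    and tangent_vec_coord [simp]: "tangent_vec M x \<kappa> \<xi> \<kappa> = \<xi>"
proof -
  \<comment> \<open>\<open>tangent_vec\<close> is defined by \<open>inv_into\<close>, so it means
    something only once the coordinate map is known to be onto.\<close>
  have "\<exists>v\<in>tangent_space M x. v \<kappa> = \<xi>"
    by (rule bexI[OF _ tangent_space_lift[OF k, of \<xi>]])
      (simp add: frechet_derivative_transition_self[OF k] k)
  then have "\<xi> \<in> (\<lambda>v. v \<kappa>) ` tangent_space M x" by blast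
  then show "tangent_vec M x \<kappa> \<xi> \<in> tangent_space M x" "tangent_vec M x \<kappa> \<xi> \<kappa> = \<xi>"
    unfolding tangent_vec_def by (rule inv_into_into, rule f_inv_into_f[where f = "\<lambda>v. v \<kappa>"])
qed

lemma tangent_vec_of_coord:
  "\<kappa> \<in> charts_at M x \<Longrightarrow> v \<in> tangent_space M x \<Longrightarrow> tangent_vec M x \<kappa> (v \<kappa>) = v"
  by (rule tangent_space_eqI) (auto intro: tangent_vec_in)

lemma tangent_space_combination:
  assumes "v \<in> tangent_space M x" "w \<in> tangent_space M x"
  shows "(\<lambda>\<kappa>. a *\<^sub>R v \<kappa> + b *\<^sub>R w \<kappa>) \<in> tangent_space M x"
  unfolding tangent_space_def
proof (intro CollectI conjI ballI allI impI)
  show "a *\<^sub>R v \<kappa> + b *\<^sub>R w \<kappa> = 0" if "\<kappa> \<notin> charts_at M x" for \<kappa>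
    using assms that by (simp add: tangent_space_def del: split_paired_All)
  fix \<kappa> \<kappa>' assume k: "\<kappa> \<in> charts_at M x" "\<kappa>' \<in> charts_at M x"
  have lin: "linear (frechet_derivative (chart_map \<kappa>' \<circ> chart_inv \<kappa>) (at (chart_map \<kappa> x)))"
    using transition_has_derivative[OF k] by (rule has_derivative_linear)
  show "a *\<^sub>R v \<kappa>' + b *\<^sub>R w \<kappa>' =
     frechet_derivative (chart_map \<kappa>' \<circ> chart_inv \<kappa>) (at (chart_map \<kappa> x)) (a *\<^sub>R v \<kappa> + b *\<^sub>R w \<kappa>)"
    using tangent_space_coord_change[OF assms(1) k] tangent_space_coord_change[OF assms(2) k]
    by (simp add: linear_add[OF lin] linear_cmul[OF lin])
qed

lemma tangent_vec_combination:
  assumes k: "\<kappa> \<in> charts_at M x"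
  shows "tangent_vec M x \<kappa> (a *\<^sub>R \<xi> + b *\<^sub>R \<eta>) =
    (\<lambda>\<kappa>'. a *\<^sub>R tangent_vec M x \<kappa> \<xi> \<kappa>' + b *\<^sub>R tangent_vec M x \<kappa> \<eta> \<kappa>')"
  by (rule tangent_space_eqI[OF k tangent_vec_in[OF k] tangent_space_combination[OF tangent_vec_in[OF k] tangent_vec_in[OF k]]])
    (simp add: k)

end

section \<open>Topology of the tangent bundle and the differential\<close>

text \<open>The inverse of the coordinate map of \<open>tangent_chart M \<kappa>\<close> on its
  image.\<close>

abbreviation tangent_param ::
  "('a, 'e::euclidean_space) manifold \<Rightarrow> ('a, 'e) chart \<Rightarrow> 'e \<times> 'e \<Rightarrow> 'a \<times> (('a, 'e) chart \<Rightarrow> 'e)" where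
  "tangent_param M \<kappa> z \<equiv> (chart_inv \<kappa> (fst z), tangent_vec M (chart_inv \<kappa> (fst z)) \<kappa> (snd z))"

context
  fixes M :: "('a, 'e::euclidean_space) manifold"
  assumes M: "smooth_manifold M"
begin

abbreviation "TM \<equiv> mtop (tangent_bundle M)"
abbreviation "tdom \<kappa> \<equiv> chart_dom (tangent_chart M \<kappa>)"
abbreviation "tmap \<kappa> \<equiv> chart_map (tangent_chart M \<kappa>)"
abbreviation "timg \<kappa> \<equiv> (chart_map \<kappa> ` chart_dom \<kappa>) \<times> (UNIV :: 'e set)"

lemma tdom_iff: "p \<in> tdom \<kappa> \<longleftrightarrow> fst p \<in> chart_dom \<kappa> \<and> snd p \<in> tangent_space M (fst p)"
  by (cases p) (simp add: tangent_chart_def)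

lemma tmap_eq: "tmap \<kappa> p = (chart_map \<kappa> (fst p), snd p \<kappa>)"
  by (cases p) (simp add: tangent_chart_def)

lemma in_charts_at: "\<kappa> \<in> atlas M \<Longrightarrow> x \<in> chart_dom \<kappa> \<Longrightarrow> \<kappa> \<in> charts_at M x"
  by (simp add: charts_at_def)

lemma openin_tangent_basic:
  assumes "\<kappa> \<in> atlas M" "open W"
  shows "openin TM {p \<in> tdom \<kappa>. tmap \<kappa> p \<in> W}"
proof -
  have "{p \<in> tdom \<kappa>. tmap \<kappa> p \<in> W} \<in>
    {{p \<in> chart_dom \<kappa>. chart_map \<kappa> p \<in> W} | \<kappa> W. \<kappa> \<in> tangent_chart M ` atlas M \<and> open W}"
    using assms by blast
  then show ?thesis by (simp add: tangent_bundle_def topology_generated_by_Basis)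
qed

lemma tdom_openin: "\<kappa> \<in> atlas M \<Longrightarrow> openin TM (tdom \<kappa>)"
  using openin_tangent_basic[of \<kappa> UNIV] by simp

lemma topspace_TM: "topspace TM = (\<Union>\<kappa>\<in>atlas M. tdom \<kappa>)"
proof
  show "topspace TM \<subseteq> (\<Union>\<kappa>\<in>atlas M. tdom \<kappa>)"
    unfolding tangent_bundle_def by (auto simp del: split_paired_Ex)
  show "(\<Union>\<kappa>\<in>atlas M. tdom \<kappa>) \<subseteq> topspace TM"
    using openin_subset[OF tdom_openin] by blast
qed

lemma tmap_image: "\<kappa> \<in> atlas M \<Longrightarrow> p \<in> tdom \<kappa> \<Longrightarrow> tmap \<kappa> p \<in> timg \<kappa>"
  by (simp add: tdom_iff tmap_eq)

lemma tangent_param_tmap: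
  assumes "\<kappa> \<in> atlas M" "p \<in> tdom \<kappa>"
  shows "tangent_param M \<kappa> (tmap \<kappa> p) = p"
  using assms chart_inv_chart[OF M] tangent_vec_of_coord[OF M in_charts_at]
  by (simp add: tdom_iff tmap_eq)

lemma tangent_param_tdom:
  assumes "\<kappa> \<in> atlas M" "z \<in> timg \<kappa>"
  shows "tangent_param M \<kappa> z \<in> tdom \<kappa>"
proof -
  have "chart_inv \<kappa> (fst z) \<in> chart_dom \<kappa>" using assms(2) by (intro chart_inv_dom[OF M]) (auto simp: mem_Times_iff)
  then show ?thesis using tangent_vec_in[OF M in_charts_at[OF assms(1)]] by (simp add: tdom_iff)
qed

lemma tmap_tangent_param:
  assumes "\<kappa> \<in> atlas M" "z \<in> timg \<kappa>"
  shows "tmap \<kappa> (tangent_param M \<kappa> z) = z"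
proof -
  have 1: "fst z \<in> chart_map \<kappa> ` chart_dom \<kappa>" using assms(2) by (simp add: mem_Times_iff)
  have "chart_inv \<kappa> (fst z) \<in> chart_dom \<kappa>" by (rule chart_inv_dom[OF M 1])
  then show ?thesis using tangent_vec_coord[OF M in_charts_at[OF assms(1)]] chart_chart_inv[OF M 1]
    by (simp add: tmap_eq)
qed

lemma tangent_transition:
  assumes k: "\<kappa> \<in> atlas M" "\<kappa>' \<in> atlas M" and z: "z \<in> timg \<kappa>" "chart_inv \<kappa> (fst z) \<in> chart_dom \<kappa>'"
  shows "tmap \<kappa>' (tangent_param M \<kappa> z) =
    ((chart_map \<kappa>' \<circ> chart_inv \<kappa>) (fst z), frechet_derivative (chart_map \<kappa>' \<circ> chart_inv \<kappa>) (at (fst z)) (snd z))"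
proof -
  have 1: "fst z \<in> chart_map \<kappa> ` chart_dom \<kappa>" using z(1) by (simp add: mem_Times_iff)
  let ?x = "chart_inv \<kappa> (fst z)"
  have x: "?x \<in> chart_dom \<kappa>" by (rule chart_inv_dom[OF M 1])
  have c: "\<kappa> \<in> charts_at M ?x" "\<kappa>' \<in> charts_at M ?x" using k x z(2) by (auto intro: in_charts_at)
  have "tangent_vec M ?x \<kappa> (snd z) \<kappa>' =
    frechet_derivative (chart_map \<kappa>' \<circ> chart_inv \<kappa>) (at (chart_map \<kappa> ?x)) (tangent_vec M ?x \<kappa> (snd z) \<kappa>)"
    by (rule tangent_space_coord_change[OF M tangent_vec_in[OF M c(1)] c])
  then show ?thesis using chart_chart_inv[OF M 1] tangent_vec_coord[OF M c(1)] by (simp add: tmap_eq)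
qed

lemma continuous_tmap:
  assumes "\<kappa> \<in> atlas M"
  shows "continuous_map (subtopology TM (tdom \<kappa>)) euclidean (tmap \<kappa>)"
proof -
  have "topspace (subtopology TM (tdom \<kappa>)) = tdom \<kappa>"
    using openin_subset[OF tdom_openin[OF assms]] by (simp add: Int_absorb1)
  moreover have "openin (subtopology TM (tdom \<kappa>)) {p \<in> tdom \<kappa>. tmap \<kappa> p \<in> W}" if "open W" for W
    using openin_tangent_basic[OF assms that] by (simp add: openin_open_subtopology[OF tdom_openin[OF assms]])
  ultimately show ?thesis by (simp add: continuous_map)
qed

text \<open>The topology is generated by preimages under charts, so only those are tested. In
  coordinates the test is openness of a preimage under a coordinate change together with its
  derivative, which is jointly continuous because the coordinate change is of class C1.\<close>

lemma continuous_tangent_param: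
  assumes k: "\<kappa> \<in> atlas M"
  shows "continuous_map (top_of_set (timg \<kappa>)) TM (tangent_param M \<kappa>)"
proof -
  let ?S = "{{p \<in> chart_dom \<kappa>. chart_map \<kappa> p \<in> W} | \<kappa> W. \<kappa> \<in> tangent_chart M ` atlas M \<and> open W}"
  have oT: "open (timg \<kappa>)" by (intro open_Times chart_image_open[OF M k] open_UNIV)
  have "continuous_map (top_of_set (timg \<kappa>)) (topology_generated_by ?S) (tangent_param M \<kappa>)"
  proof (rule continuous_on_generated_topo)
    fix U assume "U \<in> ?S"
    then obtain \<kappa>' W where k': "\<kappa>' \<in> atlas M" and W: "open W" and U: "U = {p \<in> tdom \<kappa>'. tmap \<kappa>' p \<in> W}" by blast
    let ?\<tau> = "chart_map \<kappa>' \<circ> chart_inv \<kappa>"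
    let ?V = "chart_map \<kappa> ` (chart_dom \<kappa> \<inter> chart_dom \<kappa>') \<times> (UNIV :: 'e set)"
    let ?G = "\<lambda>z. (?\<tau> (fst z), frechet_derivative ?\<tau> (at (fst z)) (snd z))"
    have C1: "Ck_on (Suc 0) ?\<tau> (chart_map \<kappa> ` (chart_dom \<kappa> \<inter> chart_dom \<kappa>'))"
      by (rule transition_C1[OF M k k'])
    have oV: "open ?V" by (intro open_Times chart_image_Int_open[OF M k] chart_dom_openin[OF M] k' open_UNIV)
    have "continuous_on ?V (\<lambda>z. ?\<tau> (fst z))"
      by (rule continuous_on_compose2[OF Ck_on_1_continuous_on[OF C1] continuous_on_fst[OF continuous_on_id]]) auto
    then have "continuous_on ?V ?G" by (intro continuous_on_Pair continuous_on_frechet_derivative[OF C1])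
    then have "open (?V \<inter> ?G -` W)" by (rule continuous_open_preimage[OF _ oV W])
    moreover have "tangent_param M \<kappa> -` U \<inter> timg \<kappa> = ?V \<inter> ?G -` W"
    proof (intro set_eqI)
      fix z
      have V: "z \<in> ?V \<longleftrightarrow> z \<in> timg \<kappa> \<and> chart_inv \<kappa> (fst z) \<in> chart_dom \<kappa>'"
        using chart_inv_chart[OF M k] by (auto simp: mem_Times_iff)
      show "z \<in> tangent_param M \<kappa> -` U \<inter> timg \<kappa> \<longleftrightarrow> z \<in> ?V \<inter> ?G -` W"
      proof (cases "z \<in> timg \<kappa>")
        case True
        have "tangent_param M \<kappa> z \<in> tdom \<kappa>' \<longleftrightarrow> chart_inv \<kappa> (fst z) \<in> chart_dom \<kappa>'"
          using tangent_param_tdom[OF k True] by (simp add: tdom_iff)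
        then show ?thesis using True V tangent_transition[OF k k' True] unfolding U by auto
      qed (use V in blast)
    qed
    ultimately have "open (tangent_param M \<kappa> -` U \<inter> timg \<kappa>)" by simp
    then have "openin (top_of_set (timg \<kappa>)) (tangent_param M \<kappa> -` U \<inter> timg \<kappa>)"
      using oT by (simp add: openin_open_eq)
    then show "openin (top_of_set (timg \<kappa>)) (tangent_param M \<kappa> -` U \<inter> topspace (top_of_set (timg \<kappa>)))" by simp
  next
    have "\<Union> ?S = topspace TM" by (simp add: tangent_bundle_def)
    moreover have "tangent_param M \<kappa> ` timg \<kappa> \<subseteq> topspace TM"
      using tangent_param_tdom[OF k] openin_subset[OF tdom_openin[OF k]] by blast
    ultimately show "tangent_param M \<kappa> ` topspace (top_of_set (timg \<kappa>)) \<subseteq> \<Union> ?S" by simp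
  qed
  then show ?thesis by (simp add: tangent_bundle_def)
qed

lemma continuous_map_TM_locally:
  assumes "\<And>p. p \<in> topspace TM \<Longrightarrow> f p \<in> topspace Y"
    and loc: "\<And>\<kappa> W. \<kappa> \<in> atlas M \<Longrightarrow> openin Y W \<Longrightarrow> \<exists>O'. open O' \<and> (\<forall>p\<in>tdom \<kappa>. f p \<in> W \<longleftrightarrow> tmap \<kappa> p \<in> O')"
  shows "continuous_map TM Y f"
  unfolding continuous_map
proof (intro conjI allI impI)
  show "f ` topspace TM \<subseteq> topspace Y" using assms(1) by blast
  fix W assume W: "openin Y W"
  have "openin TM {p \<in> tdom \<kappa>. f p \<in> W}" if k: "\<kappa> \<in> atlas M" for \<kappa>
  proof -
    obtain O' where "open O'" "\<forall>p\<in>tdom \<kappa>. f p \<in> W \<longleftrightarrow> tmap \<kappa> p \<in> O'" using loc[OF k W] by blast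
    moreover then have "{p \<in> tdom \<kappa>. f p \<in> W} = {p \<in> tdom \<kappa>. tmap \<kappa> p \<in> O'}" by blast
    ultimately show ?thesis using openin_tangent_basic[OF k] by simp
  qed
  then have "openin TM (\<Union>\<kappa>\<in>atlas M. {p \<in> tdom \<kappa>. f p \<in> W})" by blast
  moreover have "(\<Union>\<kappa>\<in>atlas M. {p \<in> tdom \<kappa>. f p \<in> W}) = {p \<in> topspace TM. f p \<in> W}"
    unfolding topspace_TM by blast
  ultimately show "openin TM {p \<in> topspace TM. f p \<in> W}" by simp
qed

lemma continuous_base_projection: "continuous_map TM (mtop M) fst"
proof (rule continuous_map_TM_locally)
  show "fst p \<in> topspace (mtop M)" if "p \<in> topspace TM" for p
    using that openin_subset[OF chart_dom_openin[OF M]] unfolding topspace_TM by (auto simp: tdom_iff simp del: split_paired_All)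
  fix \<kappa> W assume k: "\<kappa> \<in> atlas M" and W: "openin (mtop M) W"
  have "open (chart_map \<kappa> ` (chart_dom \<kappa> \<inter> W) \<times> (UNIV :: 'e set))"
    by (intro open_Times chart_image_Int_open[OF M k] W open_UNIV)
  moreover have "fst p \<in> W \<longleftrightarrow> tmap \<kappa> p \<in> chart_map \<kappa> ` (chart_dom \<kappa> \<inter> W) \<times> (UNIV :: 'e set)" if "p \<in> tdom \<kappa>" for p
  proof -
    have x: "fst p \<in> chart_dom \<kappa>" using that by (simp add: tdom_iff)
    then have "chart_map \<kappa> (fst p) \<in> chart_map \<kappa> ` (chart_dom \<kappa> \<inter> W) \<longleftrightarrow> fst p \<in> chart_dom \<kappa> \<inter> W"
      by (intro inj_on_image_mem_iff[OF chart_inj[OF M k]]) auto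
    then show ?thesis using x by (simp add: tmap_eq)
  qed
  ultimately show "\<exists>O'. open O' \<and> (\<forall>p\<in>tdom \<kappa>. fst p \<in> W \<longleftrightarrow> tmap \<kappa> p \<in> O')"
    by (intro exI conjI ballI)
qed

text \<open>Points over different base points are separated by the projection. Points over the same
  base point lie in a common chart, where their coordinates differ.\<close>

lemma Hausdorff_TM: "Hausdorff_space TM"
  unfolding Hausdorff_space_def
proof (intro allI impI, elim conjE)
  fix p q assume p: "p \<in> topspace TM" and q: "q \<in> topspace TM" and ne: "p \<noteq> q"
  show "\<exists>U V. openin TM U \<and> openin TM V \<and> p \<in> U \<and> q \<in> V \<and> disjnt U V"
  proof (cases "fst p = fst q")
    case False
    have "fst p \<in> topspace (mtop M)" "fst q \<in> topspace (mtop M)"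
      using p q continuous_map_image_subset_topspace[OF continuous_base_projection] by blast+
    then obtain U V where UV: "openin (mtop M) U" "openin (mtop M) V" "fst p \<in> U" "fst q \<in> V" "disjnt U V"
      using M False unfolding smooth_manifold_def Hausdorff_space_def by metis
    show ?thesis
    proof (intro exI conjI)
      show "openin TM {p \<in> topspace TM. fst p \<in> U}" "openin TM {p \<in> topspace TM. fst p \<in> V}"
        using openin_continuous_map_preimage[OF continuous_base_projection] UV by auto
    qed (use UV p q in \<open>auto simp: disjnt_def\<close>)
  next
    case True
    obtain \<kappa> where k: "\<kappa> \<in> atlas M" and pk: "p \<in> tdom \<kappa>" using p unfolding topspace_TM by blast
    have qk: "q \<in> tdom \<kappa>" using pk q True unfolding topspace_TM by (auto simp: tdom_iff)
    have "tmap \<kappa> p \<noteq> tmap \<kappa> q"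
      using tangent_param_tmap[OF k pk] tangent_param_tmap[OF k qk] ne by metis
    then obtain U V where UV: "open U" "open V" "tmap \<kappa> p \<in> U" "tmap \<kappa> q \<in> V" "U \<inter> V = {}"
      by (metis hausdorff)
    show ?thesis
    proof (intro exI conjI)
      show "openin TM {p \<in> tdom \<kappa>. tmap \<kappa> p \<in> U}" "openin TM {p \<in> tdom \<kappa>. tmap \<kappa> p \<in> V}"
        using openin_tangent_basic[OF k] UV by auto
      show "disjnt {p \<in> tdom \<kappa>. tmap \<kappa> p \<in> U} {p \<in> tdom \<kappa>. tmap \<kappa> p \<in> V}"
        using UV(5) by (auto simp: disjnt_def simp del: split_paired_All)
    qed (use UV pk qk in auto)
  qed
qed

lemma smooth_fun_C1:
  assumes "f \<in> smooth_fun M" "\<kappa> \<in> atlas M"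
  shows "Ck_on (Suc 0) (f \<circ> chart_inv \<kappa>) (chart_map \<kappa> ` chart_dom \<kappa>)"
  using assms unfolding smooth_fun_def Ck_fun_def by blast

lemma smooth_fun_differentiable:
  assumes "f \<in> smooth_fun M" "\<kappa> \<in> charts_at M x"
  shows "f \<circ> chart_inv \<kappa> differentiable (at (chart_map \<kappa> x))"
  using smooth_fun_C1[OF assms(1), of \<kappa>] assms(2) by (simp add: charts_at_def)

lemma differential_in_chart:
  assumes f: "f \<in> smooth_fun M" and k: "\<kappa> \<in> charts_at M x" and v: "v \<in> tangent_space M x"
  shows "differential M f (x, v) = frechet_derivative (f \<circ> chart_inv \<kappa>) (at (chart_map \<kappa> x)) (v \<kappa>)"
proof -
  let ?\<kappa> = "SOME \<kappa>. \<kappa> \<in> charts_at M x"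
  have s: "?\<kappa> \<in> charts_at M x" using k by (rule someI)
  have "frechet_derivative (f \<circ> chart_inv \<kappa>) (at (chart_map \<kappa> x)) (v \<kappa>) =
    frechet_derivative (f \<circ> chart_inv ?\<kappa>) (at (chart_map ?\<kappa> x)) (v ?\<kappa>)"
    using chain_rule_charts[OF M k s smooth_fun_differentiable[OF f s]] tangent_space_coord_change[OF M v k s] by simp
  then show ?thesis by (simp add: differential_def Let_def)
qed

text \<open>Linearity on fibres, the property by which splitting a velocity leaves the boundary
  unchanged.\<close>

lemma differential_combination:
  assumes f: "f \<in> smooth_fun M" and k: "\<kappa> \<in> charts_at M x"
    and v: "v \<in> tangent_space M x" "w \<in> tangent_space M x" "v' \<in> tangent_space M x"
    and eq: "v' \<kappa> = a *\<^sub>R v \<kappa> + b *\<^sub>R w \<kappa>"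
  shows "differential M f (x, v') = a * differential M f (x, v) + b * differential M f (x, w)"
proof -
  have lin: "linear (frechet_derivative (f \<circ> chart_inv \<kappa>) (at (chart_map \<kappa> x)))"
    by (rule linear_frechet_derivative[OF smooth_fun_differentiable[OF f k]])
  show ?thesis
    by (simp add: differential_in_chart[OF f k] v eq linear_add[OF lin] linear_cmul[OF lin])
qed

lemma continuous_differential:
  assumes f: "f \<in> smooth_fun M"
  shows "continuous_map TM euclideanreal (differential M f)"
proof (rule continuous_map_TM_locally)
  fix \<kappa> and W :: "real set" assume k: "\<kappa> \<in> atlas M" and "openin euclideanreal W"
  then have W: "open W" by simp
  let ?G = "\<lambda>z. frechet_derivative (f \<circ> chart_inv \<kappa>) (at (fst z)) (snd z)"
  have oT: "open (timg \<kappa>)" by (intro open_Times chart_image_open[OF M k] open_UNIV)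
  have "continuous_on (timg \<kappa>) ?G" by (rule continuous_on_frechet_derivative[OF smooth_fun_C1[OF f k]])
  then have "open (timg \<kappa> \<inter> ?G -` W)" by (rule continuous_open_preimage[OF _ oT W])
  moreover have "differential M f p \<in> W \<longleftrightarrow> tmap \<kappa> p \<in> timg \<kappa> \<inter> ?G -` W" if p: "p \<in> tdom \<kappa>" for p
  proof -
    have "\<kappa> \<in> charts_at M (fst p)" "snd p \<in> tangent_space M (fst p)" using p k by (auto simp: tdom_iff in_charts_at)
    from differential_in_chart[OF f this] have "differential M f p = ?G (tmap \<kappa> p)" by (simp add: tmap_eq)
    then show ?thesis using tmap_image[OF k p] by simp
  qed
  ultimately show "\<exists>O'. open O' \<and> (\<forall>p\<in>tdom \<kappa>. differential M f p \<in> W \<longleftrightarrow> tmap \<kappa> p \<in> O')"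
    by (intro exI conjI ballI)
qed simp

text \<open>Every basic open set that fits into a chart picks one such chart. The exceptional null
  sets found chart by chart can then be united.\<close>

lemma countable_atlas:
  obtains \<C> where "countable \<C>" "\<C> \<subseteq> atlas M" "topspace TM = (\<Union>\<kappa>\<in>\<C>. tdom \<kappa>)"
proof -
  have "second_countable_top (mtop M)" using M by (simp add: smooth_manifold_def)
  then obtain \<B> where B: "countable \<B>"
    "\<forall>U x. openin (mtop M) U \<and> x \<in> U \<longrightarrow> (\<exists>V\<in>\<B>. x \<in> V \<and> V \<subseteq> U)"
    unfolding second_countable_top_def by (elim exE conjE)
  define c where "c V = (SOME \<kappa>. \<kappa> \<in> atlas M \<and> V \<subseteq> chart_dom \<kappa>)" for V
  define \<B>' where "\<B>' = {V \<in> \<B>. \<exists>\<kappa>\<in>atlas M. V \<subseteq> chart_dom \<kappa>}"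
  have c: "c V \<in> atlas M" "V \<subseteq> chart_dom (c V)" if "V \<in> \<B>'" for V
  proof -
    have "\<exists>\<kappa>. \<kappa> \<in> atlas M \<and> V \<subseteq> chart_dom \<kappa>" using that unfolding \<B>'_def by blast
    then have "c V \<in> atlas M \<and> V \<subseteq> chart_dom (c V)" unfolding c_def by (rule someI_ex)
    then show "c V \<in> atlas M" "V \<subseteq> chart_dom (c V)" by auto
  qed
  show ?thesis
  proof
    show "countable (c ` \<B>')" 
      by (rule countable_image, rule countable_subset[OF _ B(1)]) (simp add: \<B>'_def)
    show sub: "c ` \<B>' \<subseteq> atlas M" using c(1) by blast
    show "topspace TM = (\<Union>\<kappa>\<in>c ` \<B>'. tdom \<kappa>)"
    proof
      show "(\<Union>\<kappa>\<in>c ` \<B>'. tdom \<kappa>) \<subseteq> topspace TM" unfolding topspace_TM using sub by blast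
      show "topspace TM \<subseteq> (\<Union>\<kappa>\<in>c ` \<B>'. tdom \<kappa>)"
      proof
        fix p assume "p \<in> topspace TM"
        then obtain \<kappa> where k: "\<kappa> \<in> atlas M" "p \<in> tdom \<kappa>" unfolding topspace_TM by blast
        then obtain V where V: "V \<in> \<B>" "fst p \<in> V" "V \<subseteq> chart_dom \<kappa>"
          using B(2) chart_dom_openin[OF M k(1)] tdom_iff by blast
        then have V': "V \<in> \<B>'" using k(1) unfolding \<B>'_def by blast
        then have "p \<in> tdom (c V)" using c(2)[OF V'] V(2) k(2) unfolding tdom_iff by blast
        then show "p \<in> (\<Union>\<kappa>\<in>c ` \<B>'. tdom \<kappa>)" using V' by blast
      qed
    qed
  qed
qed

end

section \<open>Minimizers\<close>

context
  fixes M :: "('a, 'e::euclidean_space) manifold" and \<mu> :: "('a \<times> (('a, 'e) chart \<Rightarrow> 'e)) measure"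
    and F :: "'a \<times> (('a, 'e) chart \<Rightarrow> 'e) \<Rightarrow> real" and a b :: real
  assumes M: "smooth_manifold M" and \<mu>: "\<mu> \<in> compact_radon (mtop (tangent_bundle M))"
    and F: "F \<in> borel_measurable (borel_of (mtop (tangent_bundle M)))" and b: "b > 0"
    and stationary: "\<And>K T1 T2. \<lbrakk>compactin (mtop (tangent_bundle M)) K; Sigma_Algebra.measure \<mu> K > 0;
      continuous_map (subtopology (mtop (tangent_bundle M)) K) (mtop (tangent_bundle M)) T1;
      continuous_map (subtopology (mtop (tangent_bundle M)) K) (mtop (tangent_bundle M)) T2;
      \<And>p. p \<in> K \<Longrightarrow> fst (T1 p) = fst p \<and> fst (T2 p) = fst p \<and>
        (\<exists>\<kappa>\<in>charts_at M (fst p). snd p \<kappa> = a *\<^sub>R snd (T1 p) \<kappa> + b *\<^sub>R snd (T2 p) \<kappa>);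
      \<And>p. p \<in> K \<Longrightarrow> a * F (T1 p) + b * F (T2 p) < F p\<rbrakk> \<Longrightarrow> False"
begin

text \<open>In coordinates the violating points form the projection of a Borel set of triples. If no
  null set contains it, a continuous selection over a compact set transports back to data
  \<open>K\<close>, \<open>T1\<close>, \<open>T2\<close> that \<open>stationary\<close>
  forbids.\<close>

lemma stationary_in_chart:
  assumes k: "\<kappa> \<in> atlas M"
  shows "\<exists>N\<in>null_sets \<mu>. \<forall>p\<in>tdom M \<kappa>. \<forall>w\<in>tangent_space M (fst p).
    a * F (fst p, w) + b * F (fst p, \<lambda>\<kappa>'. (1 / b) *\<^sub>R snd p \<kappa>' + (- (a / b)) *\<^sub>R w \<kappa>') < F p \<longrightarrow> p \<in> N"
proof -
  let ?X = "mtop (tangent_bundle M)"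
  let ?D = "tdom M \<kappa>" and ?\<Phi> = "tmap M \<kappa>" and ?\<Psi> = "tangent_param M \<kappa>"
  let ?U = "chart_map \<kappa> ` chart_dom \<kappa>"
  have H: "Hausdorff_space ?X" by (rule Hausdorff_TM[OF M])
  interpret \<mu>: finite_measure \<mu> by (rule compact_radon_finite[OF H \<mu>])
  have s\<mu>: "sets \<mu> = sets (borel_of ?X)" using \<mu> by (simp add: compact_radon_def radon_measure_def)
  have sp\<mu>: "space \<mu> = topspace ?X" using \<mu> by (simp add: compact_radon_def radon_measure_def)
  have D: "?D \<in> sets \<mu>" using borel_of_openin[OF tdom_openin[OF M k]] by (simp add: s\<mu>)
  have DX: "?D \<subseteq> topspace ?X" by (rule openin_subset[OF tdom_openin[OF M k]])
  have oT: "open (?U \<times> (UNIV :: 'e set))" by (intro open_Times chart_image_open[OF M k] open_UNIV)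
  \<comment> \<open>The image of \<open>\<mu>\<close> in coordinates: a finite Borel measure on the
    whole Euclidean space, as the selection theorem requires.\<close>
  define m where "m = distr (restrict_space \<mu> ?D) borel ?\<Phi>"
  have "?\<Phi> \<in> restrict_space (borel_of ?X) ?D \<rightarrow>\<^sub>M borel_of euclidean"
    by (rule measurable_restrict_borel_of[OF continuous_tmap[OF M k]])
  then have \<Phi>m: "?\<Phi> \<in> restrict_space \<mu> ?D \<rightarrow>\<^sub>M borel"
    using measurable_cong_sets[OF sets_restrict_space_cong[OF s\<mu>[symmetric]] sets_borel_of_euclidean] by blast
  have mset: "{p \<in> ?D. ?\<Phi> p \<in> A} \<in> sets \<mu>" "emeasure m A = emeasure \<mu> {p \<in> ?D. ?\<Phi> p \<in> A}"
    if A: "A \<in> sets borel" for A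
  proof -
    have eq: "?\<Phi> -` A \<inter> space (restrict_space \<mu> ?D) = {p \<in> ?D. ?\<Phi> p \<in> A}"
      using DX by (auto simp: space_restrict_space sp\<mu>)
    have "{p \<in> ?D. ?\<Phi> p \<in> A} \<in> sets (restrict_space \<mu> ?D)"
      using measurable_sets[OF \<Phi>m A] eq by simp
    then show "{p \<in> ?D. ?\<Phi> p \<in> A} \<in> sets \<mu>"
      using sets_restrict_space_iff[of ?D \<mu>] D by auto
    show "emeasure m A = emeasure \<mu> {p \<in> ?D. ?\<Phi> p \<in> A}"
      unfolding m_def using A D eq by (subst emeasure_distr[OF \<Phi>m]) (auto intro!: emeasure_restrict_space)
  qed
  have sm: "sets m = sets borel" by (simp add: m_def)
  have fm: "finite_measure m"
    by (rule finite_measureI) (simp add: m_def mset[unfolded m_def])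
  \<comment> \<open>\<open>F\<close> in coordinates, extended by 0 so as to be Borel everywhere.
    \<open>C\<close> looks only at base points in \<open>?U\<close>, where \<open>G\<close> is
    \<open>F\<close>.\<close>
  define G where "G z = (if z \<in> ?U \<times> UNIV then F (?\<Psi> z) else 0)" for z
  have G: "G \<in> borel_measurable borel"
  proof -
    have "?\<Psi> \<in> restrict_space (borel_of euclidean) (?U \<times> UNIV) \<rightarrow>\<^sub>M borel_of ?X"
      by (rule measurable_restrict_borel_of[OF continuous_tangent_param[OF M k]])
    then have "?\<Psi> \<in> restrict_space borel (?U \<times> UNIV) \<rightarrow>\<^sub>M borel_of ?X"
      using measurable_cong_sets[OF sets_restrict_space_cong[OF sets_borel_of_euclidean] refl] by blast
    then have "(\<lambda>z. F (?\<Psi> z)) \<in> borel_measurable (restrict_space borel (?U \<times> UNIV))"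
      by (rule measurable_compose[OF _ F])
    then show ?thesis unfolding G_def
      using oT by (subst measurable_restrict_space_iff[symmetric]) auto
  qed
  \<comment> \<open>The base point together with the velocity \<open>z\<close> solving
    \<open>a w + b z = v\<close>; this is where \<open>b > 0\<close> enters.\<close>
  let ?z = "\<lambda>t :: ('e \<times> 'e) \<times> 'e. (fst (fst t), (1 / b) *\<^sub>R snd (fst t) + (- (a / b)) *\<^sub>R snd t)"
  define C where "C = {t :: ('e \<times> 'e) \<times> 'e. fst (fst t) \<in> ?U \<and>
      a * G (fst (fst t), snd t) + b * G (?z t) < G (fst t)}"
  have C: "C \<in> sets borel"
  proof -
    have 1: "(\<lambda>t :: ('e \<times> 'e) \<times> 'e. G (fst (fst t), snd t)) \<in> borel_measurable borel"
      by (rule measurable_compose[OF borel_measurable_continuous_onI G]) (intro continuous_intros)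
    have 2: "(\<lambda>t :: ('e \<times> 'e) \<times> 'e. G (?z t)) \<in> borel_measurable borel"
      by (rule measurable_compose[OF borel_measurable_continuous_onI G]) (intro continuous_intros)
    have 3: "(\<lambda>t :: ('e \<times> 'e) \<times> 'e. G (fst t)) \<in> borel_measurable borel"
      by (rule measurable_compose[OF borel_measurable_continuous_onI G]) (intro continuous_intros)
    have 4: "(?U \<times> UNIV) \<times> UNIV \<in> sets (borel :: (('e \<times> 'e) \<times> 'e) measure)"
      by (intro borel_open open_Times oT open_UNIV)
    have eq: "C = ((?U \<times> UNIV) \<times> UNIV) \<inter> {t \<in> space borel. a * G (fst (fst t), snd t) + b * G (?z t) < G (fst t)}"
      unfolding C_def by (auto simp: mem_Times_iff)
    have 5: "{t \<in> space borel. a * G (fst (fst t), snd t) + b * G (?z t) < G (fst t)} \<in> sets borel"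
      using 1 2 3 by (intro borel_measurable_less borel_measurable_add borel_measurable_times borel_measurable_const)
    show ?thesis unfolding eq by (rule sets.Int[OF 4 5])
  qed
  show ?thesis
  proof (cases "\<exists>N\<in>null_sets m. fst ` C \<subseteq> N")
    case True
    then obtain N where N: "N \<in> null_sets m" "fst ` C \<subseteq> N" by blast
    then have sN: "N \<in> sets borel" by (auto simp: null_sets_def sm)
    show ?thesis
    proof (intro bexI[of _ "{p \<in> ?D. ?\<Phi> p \<in> N}"] ballI impI)
      show "{p \<in> ?D. ?\<Phi> p \<in> N} \<in> null_sets \<mu>" using N(1) mset[OF sN] by (auto simp: null_sets_def)
      fix p w assume p: "p \<in> ?D" and w: "w \<in> tangent_space M (fst p)"
        and less: "a * F (fst p, w) + b * F (fst p, \<lambda>\<kappa>'. (1 / b) *\<^sub>R snd p \<kappa>' + (- (a / b)) *\<^sub>R w \<kappa>') < F p"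
      have x: "fst p \<in> chart_dom \<kappa>" and v: "snd p \<in> tangent_space M (fst p)" using p tdom_iff[OF M] by blast+
      have c: "\<kappa> \<in> charts_at M (fst p)" by (rule in_charts_at[OF M k x])
      have G: "G (chart_map \<kappa> (fst p), \<omega> \<kappa>) = F (fst p, \<omega>)" if "\<omega> \<in> tangent_space M (fst p)" for \<omega>
        using x tangent_vec_of_coord[OF M c that] chart_inv_chart[OF M k x] by (simp add: G_def)
      let ?w = "\<lambda>\<kappa>'. (1 / b) *\<^sub>R snd p \<kappa>' + (- (a / b)) *\<^sub>R w \<kappa>'"
      have "(?\<Phi> p, w \<kappa>) \<in> C"
        using less x G[OF w] G[OF v] G[OF tangent_space_combination[OF M v w, of "1 / b" "- (a / b)"]]
        unfolding C_def by (simp add: tmap_eq[OF M])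
      then have "?\<Phi> p \<in> N" using N(2) by force
      then show "p \<in> {p \<in> ?D. ?\<Phi> p \<in> N}" using p by simp
    qed
  next
    case False
    obtain P w where P: "compact P" "Sigma_Algebra.measure m P > 0" and w: "continuous_on P w"
       and PC: "\<And>z. z \<in> P \<Longrightarrow> (z, w z) \<in> C"
      using continuous_selection_on_compact[OF fm sm C False] by metis
    have PU: "P \<subseteq> ?U \<times> UNIV" using PC unfolding C_def by (force simp: mem_Times_iff)
    let ?K = "?\<Psi> ` P"
    have KD: "?K \<subseteq> ?D" using PU tangent_param_tdom[OF M k] by blast
    have \<Phi>K: "?\<Phi> p \<in> P \<and> ?\<Psi> (?\<Phi> p) = p" if p: "p \<in> ?K" for p
    proof -
      obtain z where z: "z \<in> P" "p = ?\<Psi> z" using p by blast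
      then have "?\<Phi> p = z" using tmap_tangent_param[OF M k] PU by blast
      then show ?thesis using z by simp
    qed
    have "compactin (top_of_set (?U \<times> UNIV)) P" using P(1) PU by (simp add: compactin_subtopology)
    then have K: "compactin ?X ?K" by (rule image_compactin[OF _ continuous_tangent_param[OF M k]])
    \<comment> \<open>\<open>?K\<close> is exactly the preimage of \<open>P\<close>, so it inherits
      the positive measure.\<close>
    have "?K = {p \<in> ?D. ?\<Phi> p \<in> P}"
    proof (intro set_eqI iffI)
      fix p assume "p \<in> ?K" then show "p \<in> {p \<in> ?D. ?\<Phi> p \<in> P}" using \<Phi>K KD by blast
    next
      fix p assume "p \<in> {p \<in> ?D. ?\<Phi> p \<in> P}"
      then show "p \<in> ?K" using tangent_param_tmap[OF M k, of p] by (metis (no_types, lifting) imageI mem_Collect_eq)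
    qed
    then have "Sigma_Algebra.measure \<mu> ?K = Sigma_Algebra.measure m P"
      using mset(2)[of P] P(1) by (simp add: borel_compact Sigma_Algebra.measure_def)
    then have Kpos: "Sigma_Algebra.measure \<mu> ?K > 0" using P(2) by simp
    let ?w2 = "\<lambda>z. (1 / b) *\<^sub>R snd z + (- (a / b)) *\<^sub>R w z"
    have \<Phi>c: "continuous_map (subtopology ?X ?K) (top_of_set P) ?\<Phi>"
    proof (rule continuous_map_into_subtopology)
      show "continuous_map (subtopology ?X ?K) euclidean ?\<Phi>"
        by (rule continuous_map_from_subtopology_mono[OF continuous_tmap[OF M k] KD])
      show "?\<Phi> \<in> topspace (subtopology ?X ?K) \<rightarrow> P" using \<Phi>K by auto
    qed
    have cont: "continuous_map (subtopology ?X ?K) ?X (\<lambda>p. ?\<Psi> (fst (?\<Phi> p), \<omega> (?\<Phi> p)))"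
      if \<omega>: "continuous_on P \<omega>" for \<omega> :: "'e \<times> 'e \<Rightarrow> 'e"
    proof -
      have "continuous_map (top_of_set P) (top_of_set (?U \<times> UNIV)) (\<lambda>z. (fst z, \<omega> z))"
      proof (rule continuous_map_into_subtopology)
        show "continuous_map (top_of_set P) euclidean (\<lambda>z. (fst z, \<omega> z))"
          using \<omega> by (auto intro!: continuous_intros)
        show "(\<lambda>z. (fst z, \<omega> z)) \<in> topspace (top_of_set P) \<rightarrow> ?U \<times> UNIV" using PU by auto
      qed
      from continuous_map_compose[OF continuous_map_compose[OF \<Phi>c this] continuous_tangent_param[OF M k]]
      show ?thesis by (simp add: o_def)
    qed
    let ?T1 = "\<lambda>p. ?\<Psi> (fst (?\<Phi> p), w (?\<Phi> p))" and ?T2 = "\<lambda>p. ?\<Psi> (fst (?\<Phi> p), ?w2 (?\<Phi> p))"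
    have False
    proof (rule stationary[OF K Kpos])
      show "continuous_map (subtopology ?X ?K) ?X ?T1" by (rule cont[OF w])
      show "continuous_map (subtopology ?X ?K) ?X ?T2" by (rule cont) (intro continuous_intros w)
    next
      fix p assume p: "p \<in> ?K"
      have x: "fst p \<in> chart_dom \<kappa>" using p KD tdom_iff[OF M] by blast
      have c: "\<kappa> \<in> charts_at M (fst p)" by (rule in_charts_at[OF M k x])
      have f: "chart_inv \<kappa> (fst (?\<Phi> p)) = fst p" using chart_inv_chart[OF M k x] by (simp add: tmap_eq[OF M])
      have "snd p \<kappa> = a *\<^sub>R w (?\<Phi> p) + b *\<^sub>R ?w2 (?\<Phi> p)"
        using b by (simp add: tmap_eq[OF M] scaleR_right_distrib scaleR_right_diff_distrib)
      then have "snd p \<kappa> = a *\<^sub>R snd (?T1 p) \<kappa> + b *\<^sub>R snd (?T2 p) \<kappa>"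
        by (simp only: fst_conv snd_conv f tangent_vec_coord[OF M c])
      then show "fst (?T1 p) = fst p \<and> fst (?T2 p) = fst p \<and>
        (\<exists>\<kappa>\<in>charts_at M (fst p). snd p \<kappa> = a *\<^sub>R snd (?T1 p) \<kappa> + b *\<^sub>R snd (?T2 p) \<kappa>)"
        using c f by (simp only: fst_conv) blast
    next
      fix p assume p: "p \<in> ?K"
      have z: "?\<Phi> p \<in> P" and pz: "?\<Psi> (?\<Phi> p) = p" using \<Phi>K[OF p] by auto
      have U: "fst (?\<Phi> p) \<in> ?U" using z PU by (auto simp: mem_Times_iff)
      have "G (fst (?\<Phi> p), \<xi>) = F (?\<Psi> (fst (?\<Phi> p), \<xi>))" for \<xi> using U by (simp add: G_def)
      moreover have "G (?\<Phi> p) = F p" using z PU pz by (auto simp: G_def)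
      ultimately show "a * F (?T1 p) + b * F (?T2 p) < F p" using PC[OF z] by (simp add: C_def)
    qed
    then show ?thesis ..
  qed
qed

lemma stationary_AE:
  "AE p in \<mu>. \<forall>w\<in>tangent_space M (fst p).
    F p \<le> a * F (fst p, w) + b * F (fst p, \<lambda>\<kappa>. (1 / b) *\<^sub>R snd p \<kappa> + (- (a / b)) *\<^sub>R w \<kappa>)"
proof -
  let ?I = "\<lambda>p w. a * F (fst p, w) + b * F (fst p, \<lambda>\<kappa>'. (1 / b) *\<^sub>R snd p \<kappa>' + (- (a / b)) *\<^sub>R w \<kappa>')"
  obtain \<C> where \<C>: "countable \<C>" "\<C> \<subseteq> atlas M" "topspace (mtop (tangent_bundle M)) = (\<Union>\<kappa>\<in>\<C>. tdom M \<kappa>)"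
    using countable_atlas[OF M] by blast
  have "\<exists>N. \<forall>\<kappa>\<in>\<C>. N \<kappa> \<in> null_sets \<mu> \<and> (\<forall>p\<in>tdom M \<kappa>. \<forall>w\<in>tangent_space M (fst p). ?I p w < F p \<longrightarrow> p \<in> N \<kappa>)"
    by (rule bchoice) (use stationary_in_chart \<C>(2) in blast)
  then obtain N where N: "\<forall>\<kappa>\<in>\<C>. N \<kappa> \<in> null_sets \<mu> \<and>
     (\<forall>p\<in>tdom M \<kappa>. \<forall>w\<in>tangent_space M (fst p). ?I p w < F p \<longrightarrow> p \<in> N \<kappa>)"
    by (rule exE)
  show ?thesis
  proof (rule AE_I')
    show "(\<Union>\<kappa>\<in>\<C>. N \<kappa>) \<in> null_sets \<mu>" by (rule null_sets_UN'[OF \<C>(1)]) (use N in blast)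
    show "{p \<in> space \<mu>. \<not> (\<forall>w\<in>tangent_space M (fst p). F p \<le> ?I p w)} \<subseteq> (\<Union>\<kappa>\<in>\<C>. N \<kappa>)"
    proof
      fix p assume p: "p \<in> {p \<in> space \<mu>. \<not> (\<forall>w\<in>tangent_space M (fst p). F p \<le> ?I p w)}"
      then have "p \<in> topspace (mtop (tangent_bundle M))" using \<mu> by (simp add: compact_radon_def radon_measure_def)
      then obtain \<kappa> where k: "\<kappa> \<in> \<C>" "p \<in> tdom M \<kappa>" unfolding \<C>(3) by blast
      obtain w where "w \<in> tangent_space M (fst p)" "?I p w < F p" using p by (auto simp: not_le simp del: split_paired_All)
      then have "p \<in> N \<kappa>" using N k by blast
      then show "p \<in> (\<Union>\<kappa>\<in>\<C>. N \<kappa>)" using k(1) by blast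
    qed
  qed
qed

end

section \<open>From the inequalities to the value of the Hamiltonian\<close>

text \<open>A negative derivative would push \<open>\<phi>\<close> below \<open>\<phi> 0\<close> on
  a whole interval to the right of 0, which contains some \<open>1 / n\<close>. Starting at
  \<open>n = 2\<close> keeps \<open>1 - 1 / n\<close> positive in the later application.\<close>

lemma deriv_nonneg_along_inverse:
  fixes \<phi> :: "real \<Rightarrow> real"
  assumes d: "(\<phi> has_real_derivative d) (at 0)" and ge: "\<And>n::nat. n \<ge> 2 \<Longrightarrow> \<phi> 0 \<le> \<phi> (1 / real n)"
  shows "d \<ge> 0"
proof (rule ccontr)
  assume "\<not> ?thesis"
  then obtain \<delta> where \<delta>: "\<delta> > 0" "\<forall>h>0. h < \<delta> \<longrightarrow> \<phi> (0 + h) < \<phi> 0"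
    using DERIV_neg_dec_right[OF d] by auto
  obtain n :: nat where "max 2 (1 / \<delta>) < real n" using reals_Archimedean2 by blast
  then have n: "2 < real n" "1 / \<delta> < real n" by simp_all
  have "1 / real n < \<delta>"
    using \<delta>(1) n less_imp_inverse_less[of "1 / \<delta>" "real n"] by (simp add: inverse_eq_divide)
  moreover have "n \<ge> 2" using n(1) by linarith
  moreover have "1 / real n > 0" using n(1) by simp
  ultimately show False using \<delta>(2)[rule_format, of "1 / real n"] ge[of n] by simp
qed

lemma has_real_derivative_along_curve:
  fixes g :: "'e::real_normed_vector \<Rightarrow> real"
  assumes "(g has_derivative U) (at \<xi>)" "(\<gamma> has_vector_derivative \<eta>) (at 0)" "\<gamma> 0 = \<xi>"
  shows "((\<lambda>s. g (\<gamma> s)) has_real_derivative U \<eta>) (at 0)"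
proof -
  have "(g has_derivative U) (at (\<gamma> 0) within range \<gamma>)" using assms by (simp add: has_derivative_at_withinI)
  from vector_derivative_diff_chain_within[OF assms(2) this]
  show ?thesis by (simp add: has_real_derivative_iff_has_vector_derivative o_def)
qed

context
  fixes M :: "('a, 'e::euclidean_space) manifold"
    and c :: "('a \<Rightarrow> real) \<Rightarrow> real"
    and E :: "('a \<times> (('a, 'e) chart \<Rightarrow> 'e) \<Rightarrow> real) topology"
    and L :: "'a \<times> (('a, 'e) chart \<Rightarrow> 'e) \<Rightarrow> real"
    and \<mu> :: "('a \<times> (('a, 'e) chart \<Rightarrow> 'e)) measure"
  assumes M: "smooth_manifold M" and E: "admissible_space M c E" and L: "L \<in> topspace E"
    and \<mu>: "\<mu> \<in> competitors M c"
    and minimal: "\<forall>\<nu>\<in>competitors M c. (\<integral>p. L p \<partial>\<mu>) \<le> (\<integral>p. L p \<partial>\<nu>)"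
begin

abbreviation "\<Lambda> \<equiv> if zero_current M c then \<integral>p. L p \<partial>\<mu> else 0"

lemma competitor_compact_radon: "\<mu> \<in> compact_radon (TM M)"
  using \<mu> by (simp add: competitors_def fillings_def)

lemma L_measurable: "L \<in> borel_measurable (borel_of (TM M))"
  using E L by (simp add: admissible_space_def)

lemma L_integrable: "\<nu> \<in> competitors M c \<Longrightarrow> integrable \<nu> L"
  using E L by (simp add: admissible_space_def)

text \<open>The perturbed measure is a competitor, and the strict inequality on \<open>K\<close>
  makes its action smaller than that of \<open>\<mu>\<close>.\<close>

lemma minimizer_stationary:
  assumes a: "a \<ge> 0" and b: "b > 0" and K: "compactin (TM M) K" "Sigma_Algebra.measure \<mu> K > 0"
    and T: "continuous_map (subtopology (TM M) K) (TM M) T1" "continuous_map (subtopology (TM M) K) (TM M) T2"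
    and bary: "\<And>p. p \<in> K \<Longrightarrow> fst (T1 p) = fst p \<and> fst (T2 p) = fst p \<and>
        (\<exists>\<kappa>\<in>charts_at M (fst p). snd p \<kappa> = a *\<^sub>R snd (T1 p) \<kappa> + b *\<^sub>R snd (T2 p) \<kappa>)"
    and less: "\<And>p. p \<in> K \<Longrightarrow> a * (L (T1 p) - \<Lambda>) + b * (L (T2 p) - \<Lambda>) < L p - \<Lambda>"
  shows False
proof -
  note H = Hausdorff_TM[OF M] and \<mu>r = competitor_compact_radon
  interpret \<mu>: finite_measure \<mu> by (rule compact_radon_finite[OF H \<mu>r])
  have sp\<mu>: "space \<mu> = topspace (TM M)" by (rule space_compact_radon[OF \<mu>r])
  \<comment> \<open>The total mass of the perturbation before scaling. The factor \<open>k\<close>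
    restores mass 1 when \<open>c = 0\<close> and does nothing otherwise; \<open>r > 0\<close>
    because \<open>b > 0\<close> and \<open>K\<close> has positive measure.\<close>
  define r where "r = Sigma_Algebra.measure \<mu> (topspace (TM M) - K) + (a + b) * Sigma_Algebra.measure \<mu> K"
  have r: "r > 0" unfolding r_def using a b K(2) by (intro add_nonneg_pos mult_pos_pos) auto
  define k where "k = (if zero_current M c then 1 / r else 1)"
  have k: "k > 0" using r by (simp add: k_def)
  note pert = H \<mu>r K(1) T less_imp_le[OF k] a less_imp_le[OF b]
  define \<nu> where "\<nu> = perturb (TM M) \<mu> k a b K T1 T2"
  have \<nu>r: "\<nu> \<in> compact_radon (TM M)" unfolding \<nu>_def by (rule perturb_compact_radon[OF pert])
  interpret \<nu>: finite_measure \<nu> by (rule compact_radon_finite[OF H \<nu>r])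
  have sp\<nu>: "space \<nu> = topspace (TM M)" using \<nu>r by (simp add: compact_radon_def radon_measure_def)
  have mass: "emeasure \<nu> (space \<nu>) = ennreal (k * r)"
    unfolding sp\<nu> unfolding \<nu>_def r_def by (rule perturb_mass[OF pert])
  have T_in: "T1 p \<in> topspace (TM M)" "T2 p \<in> topspace (TM M)" "p \<in> topspace (TM M)" if "p \<in> K" for p
    using that compactin_subset_topspace[OF K(1)] continuous_map_image_subset_topspace[OF T(1)]
      continuous_map_image_subset_topspace[OF T(2)] by auto
  have tan: "snd p \<in> tangent_space M (fst p)" if "p \<in> topspace (TM M)" for p
    using that tdom_iff[OF M] unfolding topspace_TM[OF M] by blast
  have bd: "boundary M \<nu> f = c f" if f: "f \<in> smooth_fun M" for f
  proof -
    let ?df = "differential M f"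
    have dm: "?df \<in> borel_measurable (borel_of (TM M))"
      using measurable_borel_of[OF continuous_differential[OF M f]]
        measurable_cong_sets[OF refl sets_borel_of_euclidean] by blast
    have "(\<integral>p. ?df p \<partial>\<nu>) = (\<integral>p. k * (if p \<in> K then a * ?df (T1 p) + b * ?df (T2 p) else ?df p) \<partial>\<mu>)"
      unfolding \<nu>_def by (rule perturb_integral(2)[OF pert dm])
        (use integrable_compact_radon[OF H \<nu>r continuous_differential[OF M f]] in \<open>simp add: \<nu>_def\<close>)
    also have "\<dots> = (\<integral>p. k * ?df p \<partial>\<mu>)"
    proof (intro Bochner_Integration.integral_cong refl)
      fix p
      have "?df p = a * ?df (T1 p) + b * ?df (T2 p)" if p: "p \<in> K"
      proof -
        obtain \<kappa> where \<kappa>: "\<kappa> \<in> charts_at M (fst p)" "snd p \<kappa> = a *\<^sub>R snd (T1 p) \<kappa> + b *\<^sub>R snd (T2 p) \<kappa>"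
          using bary[OF p] by blast
        have "fst (T1 p) = fst p" "fst (T2 p) = fst p" using bary[OF p] by auto
        then show ?thesis
          using differential_combination[OF M f \<kappa>(1), of "snd (T1 p)" "snd (T2 p)" "snd p" a b]
            tan[OF T_in(1)[OF p]] tan[OF T_in(2)[OF p]] tan[OF T_in(3)[OF p]] \<kappa>(2)
          by (metis prod.collapse)
      qed
      then show "k * (if p \<in> K then a * ?df (T1 p) + b * ?df (T2 p) else ?df p) = k * ?df p" by simp
    qed
    also have "\<dots> = k * (\<integral>p. ?df p \<partial>\<mu>)" by simp
    also have "(\<integral>p. ?df p \<partial>\<mu>) = c f" using \<mu> f by (simp add: competitors_def fillings_def boundary_def)
    \<comment> \<open>Either \<open>c f = 0\<close> or \<open>k = 1\<close>.\<close>
    also have "k * c f = c f" using f by (auto simp: k_def zero_current_def)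
    finally show ?thesis by (simp add: boundary_def)
  qed
  have \<nu>: "\<nu> \<in> competitors M c"
    using \<nu>r bd mass r by (auto simp: competitors_def fillings_def k_def)
  have iL: "integrable \<nu> L" "integrable \<mu> L" using L_integrable \<nu> \<mu> by auto
  \<comment> \<open>For \<open>c = 0\<close> the right side is 0 and both measures have mass 1; for
    \<open>c \<noteq> 0\<close> one has \<open>\<Lambda> = 0\<close> and \<open>k = 1\<close>.
    Either way \<open>\<nu>\<close> would beat \<open>\<mu>\<close>.\<close>
  have "(\<integral>p. L p - \<Lambda> \<partial>\<nu>) < k * (\<integral>p. L p - \<Lambda> \<partial>\<mu>)"
    unfolding \<nu>_def
  proof (rule perturb_integral_less[OF pert _ _ _ k K(2) less])
    show "(\<lambda>p. L p - \<Lambda>) \<in> borel_measurable (borel_of (TM M))" using L_measurable by simp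
    show "integrable (perturb (TM M) \<mu> k a b K T1 T2) (\<lambda>p. L p - \<Lambda>)" using iL(1) unfolding \<nu>_def[symmetric] by simp
    show "integrable \<mu> (\<lambda>p. L p - \<Lambda>)" using iL(2) by simp
  qed
  moreover have "(\<integral>p. L p \<partial>\<mu>) \<le> (\<integral>p. L p \<partial>\<nu>)" using minimal \<nu> by blast
  moreover have "(\<integral>p. L p - \<Lambda> \<partial>\<nu>) = (\<integral>p. L p \<partial>\<nu>) - \<Lambda> * Sigma_Algebra.measure \<nu> (space \<nu>)"
    "(\<integral>p. L p - \<Lambda> \<partial>\<mu>) = (\<integral>p. L p \<partial>\<mu>) - \<Lambda> * Sigma_Algebra.measure \<mu> (space \<mu>)"
    using iL by (simp_all add: Bochner_Integration.integral_diff)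
  moreover have "Sigma_Algebra.measure \<mu> (space \<mu>) = 1 \<and> Sigma_Algebra.measure \<nu> (space \<nu>) = 1" if "zero_current M c"
    using \<mu> \<nu> that by (simp add: competitors_def Sigma_Algebra.measure_def)
  ultimately show False by (cases "zero_current M c") (auto simp: k_def)
qed

lemma minimizer_inequality_AE:
  assumes a: "a \<ge> 0" and b: "b > 0"
  shows "AE p in \<mu>. \<forall>w\<in>tangent_space M (fst p). L p - \<Lambda> \<le> a * (L (fst p, w) - \<Lambda>) +
    b * (L (fst p, \<lambda>\<kappa>. (1 / b) *\<^sub>R snd p \<kappa> + (- (a / b)) *\<^sub>R w \<kappa>) - \<Lambda>)"
proof (rule stationary_AE[OF M competitor_compact_radon _ b])
  show "(\<lambda>p. L p - \<Lambda>) \<in> borel_measurable (borel_of (TM M))" using L_measurable by simp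
qed (rule minimizer_stationary[OF a b])

text \<open>\<open>ineq1\<close> is the case \<open>a = 1/n\<close>, \<open>b = 1\<close>, and
  \<open>ineq2\<close> the case \<open>a = 0\<close>, \<open>b = 1 - 1/n\<close> with
  \<open>w = v\<close>, in the literal form in which the general inequality delivers them.
  Differentiability of \<open>L\<close> along the fibre at the single vector \<open>v\<close>
  suffices, since both curves used below pass through \<open>v\<close> at
  \<open>s = 0\<close>.\<close>

lemma fiber_minimality:
  fixes x v u
  assumes x: "x \<in> topspace (mtop M)" and v: "v \<in> tangent_space M x" and u: "has_fiber_derivative M L u x v"
    and ineq1: "\<And>n w. n \<ge> 2 \<Longrightarrow> w \<in> tangent_space M x \<Longrightarrow> L (x, v) - \<Lambda> \<le> (1 / real n) * (L (x, w) - \<Lambda>) +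
      1 * (L (x, \<lambda>\<kappa>. (1 / 1) *\<^sub>R v \<kappa> + (- ((1 / real n) / 1)) *\<^sub>R w \<kappa>) - \<Lambda>)"
    and ineq2: "\<And>n. n \<ge> 2 \<Longrightarrow> L (x, v) - \<Lambda> \<le> 0 * (L (x, v) - \<Lambda>) +
      (1 - 1 / real n) * (L (x, \<lambda>\<kappa>. (1 / (1 - 1 / real n)) *\<^sub>R v \<kappa> + (- (0 / (1 - 1 / real n))) *\<^sub>R v \<kappa>) - \<Lambda>)"
  shows "hamiltonian M L x u = ereal (- \<Lambda>)"
proof -
  have "x \<in> (\<Union>\<kappa>\<in>atlas M. chart_dom \<kappa>)" using M x by (simp add: smooth_manifold_def)
  then obtain \<kappa> where k: "\<kappa> \<in> charts_at M x" by (auto simp: charts_at_def simp del: split_paired_Ex)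
  let ?g = "\<lambda>\<xi>. L (x, tangent_vec M x \<kappa> \<xi>)" and ?U = "\<lambda>\<xi>. u (tangent_vec M x \<kappa> \<xi>)"
  have g: "(?g has_derivative ?U) (at (v \<kappa>))" using u k unfolding has_fiber_derivative_def by blast
  have lin: "linear ?U" using g by (rule has_derivative_linear)
  note tv = tangent_vec_of_coord[OF M k]
  have comb: "(\<lambda>\<kappa>'. s *\<^sub>R v \<kappa>' + t *\<^sub>R w \<kappa>') = tangent_vec M x \<kappa> (s *\<^sub>R v \<kappa> + t *\<^sub>R w \<kappa>)"
    if "w \<in> tangent_space M x" for s t w
    by (simp add: tangent_vec_combination[OF M k] tv[OF v] tv[OF that])
  have lower: "u w \<le> L (x, w) - \<Lambda>" if w: "w \<in> tangent_space M x" for w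
  proof -
    have "((\<lambda>s. v \<kappa> - s *\<^sub>R w \<kappa>) has_vector_derivative - w \<kappa>) (at 0)"
      by (auto intro!: derivative_eq_intros)
    from has_real_derivative_along_curve[OF g this]
    have "((\<lambda>s. ?g (v \<kappa> - s *\<^sub>R w \<kappa>)) has_real_derivative ?U (- w \<kappa>)) (at 0)" by simp
    \<comment> \<open>This function equals \<open>L (x, v) - \<Lambda>\<close> at 0 and dominates
      that value at each \<open>1 / n\<close> by \<open>ineq1\<close>; its derivative is
      \<open>L (x, w) - \<Lambda> - u w\<close>.\<close>
    then have "((\<lambda>s. s * (L (x, w) - \<Lambda>) + (?g (v \<kappa> - s *\<^sub>R w \<kappa>) - \<Lambda>)) has_real_derivative
        ((L (x, w) - \<Lambda>) + ?U (- w \<kappa>))) (at 0)"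
      by (auto intro!: derivative_eq_intros)
    then have "(L (x, w) - \<Lambda>) + ?U (- w \<kappa>) \<ge> 0"
    proof (rule deriv_nonneg_along_inverse)
      fix n :: nat assume "n \<ge> 2"
      from ineq1[OF this w] show "0 * (L (x, w) - \<Lambda>) + (?g (v \<kappa> - 0 *\<^sub>R w \<kappa>) - \<Lambda>)
        \<le> 1 / real n * (L (x, w) - \<Lambda>) + (?g (v \<kappa> - (1 / real n) *\<^sub>R w \<kappa>) - \<Lambda>)"
        unfolding comb[OF w] by (simp add: tv[OF v])
    qed
    moreover have "?U (- w \<kappa>) = - u w" using linear_neg[OF lin, of "w \<kappa>"] tv[OF w] by simp
    ultimately show ?thesis by simp
  qed
  have upper: "L (x, v) - \<Lambda> \<le> u v"
  proof -
    \<comment> \<open>Mass \<open>1 - s\<close> moving at speed \<open>1 / (1 - s)\<close> has the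
      same boundary. Differentiating its cost at \<open>s = 0\<close> gives
      \<open>u v - (L (x, v) - \<Lambda>)\<close>.\<close>
    have "((\<lambda>s. (1 / (1 - s)) *\<^sub>R v \<kappa>) has_vector_derivative v \<kappa>) (at 0)"
      by (auto intro!: derivative_eq_intros)
    from has_real_derivative_along_curve[OF g this]
    have "((\<lambda>s. ?g ((1 / (1 - s)) *\<^sub>R v \<kappa>)) has_real_derivative ?U (v \<kappa>)) (at 0)" by simp
    then have "((\<lambda>s. (1 - s) * (?g ((1 / (1 - s)) *\<^sub>R v \<kappa>) - \<Lambda>)) has_real_derivative
        (?U (v \<kappa>) - (L (x, v) - \<Lambda>))) (at 0)"
      by (auto intro!: derivative_eq_intros simp: tv[OF v])
    then have "?U (v \<kappa>) - (L (x, v) - \<Lambda>) \<ge> 0"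
    proof (rule deriv_nonneg_along_inverse)
      fix n :: nat assume "n \<ge> 2"
      from ineq2[OF this] show "(1 - 0) * (?g ((1 / (1 - 0)) *\<^sub>R v \<kappa>) - \<Lambda>)
        \<le> (1 - 1 / real n) * (?g ((1 / (1 - 1 / real n)) *\<^sub>R v \<kappa>) - \<Lambda>)"
        unfolding comb[OF v] by (simp add: tv[OF v])
    qed
    then show ?thesis using tv[OF v] by simp
  qed
  show ?thesis unfolding hamiltonian_def
  proof (rule antisym)
    show "(SUP w\<in>tangent_space M x. ereal (u w - L (x, w))) \<le> ereal (- \<Lambda>)"
      using lower by (intro SUP_least) (simp add: algebra_simps)
    have "ereal (- \<Lambda>) \<le> ereal (u v - L (x, v))" using upper by simp
    also have "\<dots> \<le> (SUP w\<in>tangent_space M x. ereal (u w - L (x, w)))" by (rule SUP_upper[OF v])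
    finally show "ereal (- \<Lambda>) \<le> (SUP w\<in>tangent_space M x. ereal (u w - L (x, w)))" .
  qed
qed

text \<open>Only countably many pairs \<open>(a, b)\<close> are used, so their exceptional sets
  unite to one null set, which depends neither on \<open>w\<close> nor on \<open>u\<close>.\<close>

lemma hamiltonian_AE:
  "AE (x, v) in \<mu>. \<forall>u. has_fiber_derivative M L u x v \<longrightarrow> hamiltonian M L x u = ereal (- \<Lambda>)"
proof -
  have "AE p in \<mu>. \<forall>n\<in>{2::nat..}. \<forall>w\<in>tangent_space M (fst p). L p - \<Lambda> \<le> (1 / real n) * (L (fst p, w) - \<Lambda>) +
      1 * (L (fst p, \<lambda>\<kappa>. (1 / 1) *\<^sub>R snd p \<kappa> + (- ((1 / real n) / 1)) *\<^sub>R w \<kappa>) - \<Lambda>)"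
    by (rule AE_ball_countable'[OF minimizer_inequality_AE]) simp_all
  moreover have "AE p in \<mu>. \<forall>n\<in>{2::nat..}. \<forall>w\<in>tangent_space M (fst p). L p - \<Lambda> \<le> 0 * (L (fst p, w) - \<Lambda>) +
      (1 - 1 / real n) * (L (fst p, \<lambda>\<kappa>. (1 / (1 - 1 / real n)) *\<^sub>R snd p \<kappa> + (- (0 / (1 - 1 / real n))) *\<^sub>R w \<kappa>) - \<Lambda>)"
    by (rule AE_ball_countable'[OF minimizer_inequality_AE]) simp_all
  ultimately show ?thesis
  proof (rule AE_mp[OF AE_conjI], intro AE_I2 impI)
    fix p assume p: "p \<in> space \<mu>"
      and h: "(\<forall>n\<in>{2::nat..}. \<forall>w\<in>tangent_space M (fst p). L p - \<Lambda> \<le> (1 / real n) * (L (fst p, w) - \<Lambda>) +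
      1 * (L (fst p, \<lambda>\<kappa>. (1 / 1) *\<^sub>R snd p \<kappa> + (- ((1 / real n) / 1)) *\<^sub>R w \<kappa>) - \<Lambda>)) \<and>
      (\<forall>n\<in>{2::nat..}. \<forall>w\<in>tangent_space M (fst p). L p - \<Lambda> \<le> 0 * (L (fst p, w) - \<Lambda>) +
      (1 - 1 / real n) * (L (fst p, \<lambda>\<kappa>. (1 / (1 - 1 / real n)) *\<^sub>R snd p \<kappa> + (- (0 / (1 - 1 / real n))) *\<^sub>R w \<kappa>) - \<Lambda>))"
    obtain x v where xv: "p = (x, v)" by (cases p)
    have pT: "p \<in> topspace (TM M)" using p competitor_compact_radon by (simp add: compact_radon_def radon_measure_def)
    have v: "v \<in> tangent_space M x" using pT tdom_iff[OF M] unfolding topspace_TM[OF M] xv by fastforce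
    have x: "x \<in> topspace (mtop M)"
      using pT continuous_map_image_subset_topspace[OF continuous_base_projection[OF M]] unfolding xv by force
    have "hamiltonian M L x u = ereal (- \<Lambda>)" if "has_fiber_derivative M L u x v" for u
      by (rule fiber_minimality[OF x v that]) (use h v in \<open>simp_all only: xv fst_conv snd_conv atLeast_iff\<close>)
    then show "case p of (x, v) \<Rightarrow> \<forall>u. has_fiber_derivative M L u x v \<longrightarrow> hamiltonian M L x u = ereal (- \<Lambda>)"
      by (simp add: xv)
  qed
qed

end

theorem corollary2p3:
  fixes M :: "('a, 'e::euclidean_space) manifold"
    and c :: "('a \<Rightarrow> real) \<Rightarrow> real"
    and E :: "('a \<times> (('a, 'e) chart \<Rightarrow> 'e) \<Rightarrow> real) topology"
    and L :: "'a \<times> (('a, 'e) chart \<Rightarrow> 'e) \<Rightarrow> real"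
    and \<mu> :: "('a \<times> (('a, 'e) chart \<Rightarrow> 'e)) measure"
  assumes "smooth_manifold M"
    and "normal_0_current M c"
    and "is_boundary M c"
    and "admissible_space M c E"
    and "L \<in> topspace E"
    and "\<mu> \<in> competitors M c"
    and "\<forall>\<nu>\<in>competitors M c. (\<integral>p. L p \<partial>\<mu>) \<le> (\<integral>p. L p \<partial>\<nu>)"
  shows "AE (x, v) in \<mu>. (x, v) \<in> msupport (mtop (tangent_bundle M)) \<mu> \<longrightarrow>
    (\<forall>u. has_fiber_derivative M L u x v \<longrightarrow>
       hamiltonian M L x u = ereal (if zero_current M c then - (\<integral>p. L p \<partial>\<mu>) else 0))"
  by (rule eventually_mono[OF hamiltonian_AE[OF assms(1,4-7)]]) auto

end
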